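(* Let $(\mathrm{Sp}(V),\mathrm O(W,B))$ be a dual pair over $\mathbb F_q$ ($q$ odd) in the symplectic stable or metastable range (resp. in the orthogonal stable or metastable range). Let $k\ge0$ be at most the dimension of a maximal isotropic subspace of $W$ (resp. $k\le\frac12\dim V$), and let $\rho$ be an irreducible representation of $\mathrm O(W[-k],B[-k])$ (resp. of $\mathrm{Sp}(V[-k])$). Let $\theta=\binom{\lambda_1<\dots<\lambda_a}{\mu_1<\dots<\mu_b}$ be the symbol of the altered factor of the unipotent part of its classification data, with the rows arranged so that the construction of the eta (resp. zeta) correspondence at $\rho$ appends the new coordinate $N'$ to the top row, and suppose $\lambda_a<N'$. Put $\lambda_{a+1}=N'$, $k^{(i)}=k-N'+\lambda_i$ for $1\le i\le a+1$, and let $i_0$ be the minimal $i$ with $k^{(i)}\ge0$. Then the alternating sum of parabolically induced representations $$\bigoplus_{i=i_0}^{a+1}(-1)^{a+1-i}\cdot\mathrm{Ind}_{P_{k^{(i)}}}\binom{\lambda_1<\dots<\widehat{\lambda_i}<\dots<\lambda_a<N'}{\mu_1<\dots<\mu_b}$$ (the hat meaning omission; for $i=a+1$ the symbol is $\theta$ itself) is equal to the sum of all symbols $$\binom{\lambda_1'<\dots<\lambda_{a'}'}{\mu_1'<\dots<\mu_{b'}'}\subseteq\mathrm{Ind}_{P_k}\binom{\lambda_1<\dots<\lambda_a}{\mu_1<\dots<\mu_b}\quad\text{such that}\quad\lambda'_{a'}<N'+(a'-a).$$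
   Context: **Ranges.** Let $\dim V=2N$. The symplectic stable and metastable ranges together consist of the pairs with $m<N$ if $\dim W=2m+1$, and $m\le N$ if $\dim W=2m$. The orthogonal stable and metastable ranges together consist of the pairs with $N\le m$ if $\dim W=2m+1$, and $N<m$ if $\dim W=2m$. If $B$ is a sum of $k$ hyperbolic planes and a complement, the complement is $(W[-k],B[-k])$ of dimension $\dim W-2k$; $V[-k]$ is a symplectic space of dimension $2N-2k$. **Symbols.** A symbol is a pair of strictly increasing finite sequences of non-negative integers $\binom{\lambda_1<\dots<\lambda_a}{\mu_1<\dots<\mu_b}$, $(\lambda_1,\mu_1)\neq(0,0)$. Symbols with $a-b$ odd and $\sum\lambda_i+\sum\mu_i=r+\frac{(a+b-1)^2}4$ index (up to exchanging rows) the irreducible unipotent representations of $\mathrm{Sp}_{2r}(\mathbb F_q)$ and of $\mathrm{SO}_{2r+1}(\mathbb F_q)$ (types B, C, rank $r$); symbols with $a-b\equiv0$ (resp. $2$) mod $4$ and $\sum\lambda_i+\sum\mu_i=r+\frac{(a+b)(a+b-2)}4$ index those of $\mathrm{SO}_{2r}^+(\mathbb F_q)$ (resp. $\mathrm{SO}_{2r}^-(\mathbb F_q)$) (types D, ${}^2$D, rank $r$). A representation is denoted by its symbol. **Altered factor and $N'$.** By Lusztig's parametrization, an irreducible representation of $G=\mathrm{Sp}_{2n}$, $\mathrm{SO}_{2n+1}$, $\mathrm{SO}_{2n}^\pm$ is given by a semisimple class $(s)$ in the dual group $G^*(\mathbb F_q)$ ($\mathrm{SO}_{2n+1}$, $\mathrm{Sp}_{2n}$,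 $\mathrm{SO}_{2n}^\pm$ respectively), a unipotent irreducible representation $u$ of the dual of the identity component of the centralizer of $s$, and possibly sign data; for full orthogonal groups one adds extension signs. The altered factor is the tensor factor of $u$ coming from the eigenvalue $(-1)^{\dim W}$ of $s$; it is given by a symbol $\theta$ with row lengths $a,b$. The eta correspondence $\eta^V_{W[-k],B[-k]}$ (resp. zeta correspondence $\zeta^{W,B}_{V[-k]}$) replaces $\theta$ by the symbol obtained by appending the following new coordinate $N'$ at the end of one of its rows (which row depends on the sign data); this is a legal symbol precisely when $N'$ exceeds the largest entry of that row: - symplectic ranges, $\dim W=2m+1$: $\theta$ is of type B, $N'=N'_\rho=N-(m-k)+\frac{a+b-1}2$; - symplectic ranges, $\dim W=2m$: $\theta$ is of type D or ${}^2$D, $N'=N'_\rho=N-(m-k)+\frac{a+b}2$; - orthogonal ranges, $\dim W=2m+1$: $\theta$ is of type D or ${}^2$D, $N'=m'_\rho=m-(N-k)+\frac{a+b}2$; - orthogonal ranges, $\dim W=2m$: $\theta$ is of type C, $N'=m'_\rho=m-(N-k)+\frac{a+b-1}2$. **Induction.** For a group $K$ of the type of $\theta$ and rank $\mathrm{rank}(\theta)+k$, $P_j\subset K$ is the standard maximal parabolic with Levi factor $K[-j]\times\mathrm{GL}_j(\mathbb F_q)$, $K[-j]$ being of the same type and rank smaller by $j$; $\mathrm{Ind}_{P_j}$ of a symbol of $K[-j]$ is the parabolic (Harish-Chandra) induction to $K$ with $\mathrm{GL}_j(\mathbb F_q)$ and the unipotent radical acting trivially. The order of rows is remembered (for types D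 and ${}^2$D the two orderings of the rows label the two extensions to the full orthogonal group): the constituents $\binom{\lambda'_1<\dots<\lambda'_{a'}}{\mu'_1<\dots<\mu'_{b'}}$ of $\mathrm{Ind}_{P_j}\binom{\lambda_1<\dots<\lambda_a}{\mu_1<\dots<\mu_b}$ satisfy $a'-b'=a-b$ and are those for which, for some $j_1+j_2=j$, the partition $(\lambda'_{a'}-(a'-1),\dots,\lambda'_2-1,\lambda'_1)$ is obtained from $(\lambda_a-(a-1),\dots,\lambda_2-1,\lambda_1)$ by adding a horizontal strip of $j_1$ boxes (no two in the same column), and the partition attached in the same way to $\mu'$ is obtained from that attached to $\mu$ by adding a horizontal strip of $j_2$ boxes. *)

theory Defs
  imports
    "HOL-Algebra.Algebraic_Closure_Type"
    "Jordan_Normal_Form.Char_Poly"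
begin

section \<open>Complex characters of finite groups\<close>

definition GL_group :: "nat \<Rightarrow> 'a::field mat monoid" where
  "GL_group n = \<lparr>carrier = {M \<in> carrier_mat n n. det M \<noteq> 0}, monoid.mult = (*), one = 1\<^sub>m n\<rparr>"

definition irreducible_rep :: "('g, 'x) monoid_scheme \<Rightarrow> nat \<Rightarrow> ('g \<Rightarrow> complex mat) \<Rightarrow> bool" where
  "irreducible_rep G n R \<longleftrightarrow>
     n > 0 \<and> R \<in> hom G (GL_group n) \<and>
     (\<forall>S \<subseteq> carrier_vec n.
        0\<^sub>v n \<in> S \<and> (\<forall>u\<in>S. \<forall>v\<in>S. u + v \<in> S) \<and> (\<forall>c. \<forall>v\<in>S. c \<cdot>\<^sub>v v \<in> S) \<and>
        (\<forall>g\<in>carrier G. \<forall>v\<in>S. R g *\<^sub>v v \<in> S)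
        \<longrightarrow> S = {0\<^sub>v n} \<or> S = carrier_vec n)"

text \<open>Representations are taken up to isomorphism and hence represented by their characters.
  Characters are extended by 0 outside the group.\<close>

definition irr_chars :: "('g, 'x) monoid_scheme \<Rightarrow> ('g \<Rightarrow> complex) set" where
  "irr_chars G =
     {\<chi>. \<exists>n R. irreducible_rep G n R \<and>
        \<chi> = (\<lambda>g. if g \<in> carrier G then \<Sum>i<n. R g $$ (i, i) else 0)}"

definition char_inner ::
    "('g, 'x) monoid_scheme \<Rightarrow> ('g \<Rightarrow> complex) \<Rightarrow> ('g \<Rightarrow> complex) \<Rightarrow> complex" where
  "char_inner G \<phi> \<psi> =
     (\<Sum>g\<in>carrier G. \<phi> (inv\<^bsub>G\<^esub> g) * \<psi> g) / of_nat (card (carrier G))"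

definition constituent ::
    "('g, 'x) monoid_scheme \<Rightarrow> ('g \<Rightarrow> complex) \<Rightarrow> ('g \<Rightarrow> complex) \<Rightarrow> bool" where
  "constituent G \<chi> \<phi> \<longleftrightarrow> \<chi> \<in> irr_chars G \<and> char_inner G \<chi> \<phi> \<noteq> 0"


section \<open>Forms and classical groups over a finite field\<close>

text \<open>A form on a coordinate space is given by its Gram matrix.\<close>

definition symplectic_form :: "'f::field mat \<Rightarrow> bool" where
  "symplectic_form A \<longleftrightarrow> square_mat A \<and> det A \<noteq> 0 \<and>
     transpose_mat A = - A \<and> (\<forall>i < dim_row A. A $$ (i, i) = 0)"

definition orthogonal_form :: "'f::field mat \<Rightarrow> bool" where
  "orthogonal_form B \<longleftrightarrow> square_mat B \<and> det B \<noteq> 0 \<and> transpose_mat B = B"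

definition isom_group :: "'f::field mat \<Rightarrow> 'f mat monoid" where
  "isom_group J =
     \<lparr>carrier = {g \<in> carrier_mat (dim_row J) (dim_row J). transpose_mat g * J * g = J},
      monoid.mult = (*), one = 1\<^sub>m (dim_row J)\<rparr>"

definition special_isom_group :: "'f::field mat \<Rightarrow> 'f mat monoid" where
  "special_isom_group J = (isom_group J)\<lparr>carrier := {g \<in> carrier (isom_group J). det g = 1}\<rparr>"

text \<open>The columns of \<open>Y\<close> form a basis of a \<open>d\<close>-dimensional totally isotropic subspace.\<close>

definition isotropic_basis :: "'f::field mat \<Rightarrow> nat \<Rightarrow> 'f mat \<Rightarrow> bool" where
  "isotropic_basis J d Y \<longleftrightarrow>
     Y \<in> carrier_mat (dim_row J) d \<and> inj_on (\<lambda>v. Y *\<^sub>v v) (carrier_vec d) \<and>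
     transpose_mat Y * J * Y = 0\<^sub>m d d"

definition witt_index :: "'f::field mat \<Rightarrow> nat" where
  "witt_index J = Max {d. \<exists>Y. isotropic_basis J d Y}"

text \<open>The orthogonal sum of \<open>k\<close> hyperbolic planes, symmetric for \<open>\<epsilon> = 1\<close> and
  alternating for \<open>\<epsilon> = - 1\<close>; \<open>hyperbolic_complement \<epsilon> k J U\<close> says that the form \<open>J\<close> is
  isometric to the orthogonal sum of \<open>U\<close> and these planes.\<close>

definition hyperbolic_form :: "'f::field \<Rightarrow> nat \<Rightarrow> 'f mat" where
  "hyperbolic_form \<epsilon> k = four_block_mat (0\<^sub>m k k) (1\<^sub>m k) (\<epsilon> \<cdot>\<^sub>m 1\<^sub>m k) (0\<^sub>m k k)"

definition hyperbolic_complement :: "'f::field \<Rightarrow> nat \<Rightarrow> 'f mat \<Rightarrow> 'f mat \<Rightarrow> bool" where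
  "hyperbolic_complement \<epsilon> k J U \<longleftrightarrow>
     (\<exists>d P. dim_row J = d + 2 * k \<and> U \<in> carrier_mat d d \<and>
        P \<in> carrier_mat (d + 2 * k) (d + 2 * k) \<and> det P \<noteq> 0 \<and>
        transpose_mat P * J * P =
          four_block_mat U (0\<^sub>m d (2 * k)) (0\<^sub>m (2 * k) d) (hyperbolic_form \<epsilon> k))"

datatype cls_type = TypeB | TypeC | TypeD | Type2D

text \<open>Standard Gram matrices in a basis adapted to a full isotropic flag. For \<open>Type2D\<close> the
  two middle coordinates carry the anisotropic form \<open>x\<^sup>2 - \<epsilon> y\<^sup>2\<close> with \<open>\<epsilon>\<close> a non-square
  (rank at least 1; there are no symbols of this type in rank 0).\<close>

fun cls_gram :: "cls_type \<Rightarrow> nat \<Rightarrow> 'f::field mat" where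
  "cls_gram TypeB r = mat (2 * r + 1) (2 * r + 1) (\<lambda>(i, l). if i + l = 2 * r then 1 else 0)"
| "cls_gram TypeC r = mat (2 * r) (2 * r)
     (\<lambda>(i, l). if i + l + 1 = 2 * r then (if i < l then 1 else - 1) else 0)"
| "cls_gram TypeD r = mat (2 * r) (2 * r) (\<lambda>(i, l). if i + l + 1 = 2 * r then 1 else 0)"
| "cls_gram Type2D r = mat (2 * r) (2 * r)
     (\<lambda>(i, l). if i + 1 = r \<and> l + 1 = r then 1
               else if i = r \<and> l = r then - (SOME \<epsilon>. \<nexists>y. y ^ 2 = \<epsilon>)
               else if i + l + 1 = 2 * r \<and> i + 1 \<noteq> r \<and> i \<noteq> r then 1 else 0)"

text \<open>\<open>SO\<^bsub>2r+1\<^esub>\<close>, \<open>Sp\<^bsub>2r\<^esub>\<close> and the full orthogonal groups \<open>O\<^bsub>2r\<^esub>\<^sup>+\<close>, \<open>O\<^bsub>2r\<^esub>\<^sup>-\<close>: in types D and 2D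
  the order of the rows of a symbol tells apart the two extensions to the full orthogonal group.\<close>

fun cls_group :: "cls_type \<Rightarrow> nat \<Rightarrow> 'f::field mat monoid" where
  "cls_group TypeB r = special_isom_group (cls_gram TypeB r)"
| "cls_group t r = isom_group (cls_gram t r)"

text \<open>The stabilizer of the isotropic span of the first \<open>j\<close> basis vectors. Its projection to
  the Levi factor \<open>K[-j]\<close> reads off the action on the middle coordinates.\<close>

definition cls_parabolic :: "cls_type \<Rightarrow> nat \<Rightarrow> nat \<Rightarrow> 'f::field mat set" where
  "cls_parabolic t r j =
     {g \<in> carrier (cls_group t r). \<forall>i l. j \<le> i \<and> i < dim_row g \<and> l < j \<longrightarrow> g $$ (i, l) = 0}"

definition levi_part :: "nat \<Rightarrow> 'f mat \<Rightarrow> 'f mat" where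
  "levi_part j g =
     mat (dim_row g - 2 * j) (dim_row g - 2 * j) (\<lambda>(i, l). g $$ (i + j, l + j))"

text \<open>Parabolic induction from \<open>K[-j]\<close> to \<open>K\<close>, with \<open>K\<close> of rank \<open>r\<close>: inflate along \<open>levi_part j\<close>
  (so that \<open>GL\<^sub>j\<close> and the unipotent radical act trivially), then induce from \<open>P\<^sub>j\<close>.\<close>

definition hc_ind ::
    "cls_type \<Rightarrow> nat \<Rightarrow> nat \<Rightarrow> ('f::{field,finite} mat \<Rightarrow> complex) \<Rightarrow> 'f mat \<Rightarrow> complex" where
  "hc_ind t r j \<chi> g =
     (let K = cls_group t r; P = cls_parabolic t r j in
      if g \<in> carrier K then
        (\<Sum>x\<in>carrier K.
           let y = inv\<^bsub>K\<^esub> x \<otimes>\<^bsub>K\<^esub> g \<otimes>\<^bsub>K\<^esub> x in if y \<in> P then \<chi> (levi_part j y) else 0)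
        / of_nat (card P)
      else 0)"


section \<open>Symbols\<close>

type_synonym symbol = "nat list \<times> nat list"

fun is_symbol :: "symbol \<Rightarrow> bool" where
  "is_symbol (ls, ms) \<longleftrightarrow> sorted_wrt (<) ls \<and> sorted_wrt (<) ms \<and>
     \<not> (ls \<noteq> [] \<and> ms \<noteq> [] \<and> hd ls = 0 \<and> hd ms = 0)"

definition defect :: "symbol \<Rightarrow> int" where
  "defect \<Lambda> = int (length (fst \<Lambda>)) - int (length (snd \<Lambda>))"

definition symbols :: "cls_type \<Rightarrow> nat \<Rightarrow> symbol set" where
  "symbols t r =
     {\<Lambda>. is_symbol \<Lambda> \<and>
        (let n = length (fst \<Lambda>) + length (snd \<Lambda>);
             s = sum_list (fst \<Lambda>) + sum_list (snd \<Lambda>)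
         in case t of
              TypeB \<Rightarrow> odd (defect \<Lambda>) \<and> s = r + (n - 1)\<^sup>2 div 4
            | TypeC \<Rightarrow> odd (defect \<Lambda>) \<and> s = r + (n - 1)\<^sup>2 div 4
            | TypeD \<Rightarrow> defect \<Lambda> mod 4 = 0 \<and> s = r + n * (n - 2) div 4
            | Type2D \<Rightarrow> defect \<Lambda> mod 4 = 2 \<and> s = r + n * (n - 2) div 4)}"

text \<open>The Young diagram of the partition \<open>(\<lambda>\<^sub>a - (a - 1), \<dots>, \<lambda>\<^sub>2 - 1, \<lambda>\<^sub>1)\<close> attached to a row,
  as a set of pairs (row index, column index).\<close>

definition row_diagram :: "nat list \<Rightarrow> (nat \<times> nat) set" where
  "row_diagram ls =
     {(i, c). i < length ls \<and> c < rev ls ! i - (length ls - 1 - i)}"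

definition adds_horizontal_strip :: "nat \<Rightarrow> nat list \<Rightarrow> nat list \<Rightarrow> bool" where
  "adds_horizontal_strip n ls ls' \<longleftrightarrow>
     row_diagram ls \<subseteq> row_diagram ls' \<and>
     card (row_diagram ls' - row_diagram ls) = n \<and>
     inj_on snd (row_diagram ls' - row_diagram ls)"

definition strip_symbols :: "nat \<Rightarrow> symbol \<Rightarrow> symbol set" where
  "strip_symbols j \<Lambda> =
     {\<Lambda>'. is_symbol \<Lambda>' \<and> defect \<Lambda>' = defect \<Lambda> \<and>
        (\<exists>j1 j2. j1 + j2 = j \<and> adds_horizontal_strip j1 (fst \<Lambda>) (fst \<Lambda>') \<and>
                 adds_horizontal_strip j2 (snd \<Lambda>) (snd \<Lambda>'))}"

text \<open>A labelling of irreducible unipotent characters by symbols. Unipotent characters come from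
  Deligne-Lusztig theory, which the libraries do not provide, so the labelling enters through what is
  known about it: symbols give irreducible characters, symbols give the same character only if
  they differ by exchanging the rows in types B and C, and parabolically induced characters
  decompose without multiplicities by adding horizontal strips.\<close>

definition unipotent_labelling ::
    "(cls_type \<Rightarrow> symbol \<Rightarrow> 'f::{field,finite} mat \<Rightarrow> complex) \<Rightarrow> bool" where
  "unipotent_labelling unip \<longleftrightarrow>
     (\<forall>t r. \<forall>\<Lambda>\<in>symbols t r. unip t \<Lambda> \<in> irr_chars (cls_group t r)) \<and>
     (\<forall>t r. \<forall>\<Lambda>\<in>symbols t r. \<forall>\<Lambda>'\<in>symbols t r.
        unip t \<Lambda> = unip t \<Lambda>' \<longleftrightarrow>
          \<Lambda>' = \<Lambda> \<or> (t = TypeB \<or> t = TypeC) \<and> \<Lambda>' = prod.swap \<Lambda>) \<and>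
     (\<forall>t r j. \<forall>\<Lambda>\<in>symbols t r. \<forall>g\<in>carrier (cls_group t (r + j)).
        hc_ind t (r + j) j (unip t \<Lambda>) g = (\<Sum>\<Lambda>'\<in>strip_symbols j \<Lambda>. unip t \<Lambda>' g))"


section \<open>Dual pairs, ranges and classification data\<close>

text \<open>\<open>A\<close> is the form on \<open>V\<close>, \<open>B\<close> the form on \<open>W\<close>. \<open>Eta\<close> refers to the symplectic stable and
  metastable ranges, \<open>Zeta\<close> to the orthogonal ones.\<close>

datatype side = Eta | Zeta

fun in_range :: "side \<Rightarrow> 'f::field mat \<Rightarrow> 'f mat \<Rightarrow> bool" where
  "in_range Eta A B \<longleftrightarrow>
     (let N = dim_row A div 2; m = dim_row B div 2 in if odd (dim_row B) then m < N else m \<le> N)"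
| "in_range Zeta A B \<longleftrightarrow>
     (let N = dim_row A div 2; m = dim_row B div 2 in if odd (dim_row B) then N \<le> m else N < m)"

text \<open>\<open>U\<close> is the form on \<open>W[-k]\<close> in the first case and on \<open>V[-k]\<close> in the second.\<close>

fun k_complement :: "side \<Rightarrow> 'f::field mat \<Rightarrow> 'f mat \<Rightarrow> nat \<Rightarrow> 'f mat \<Rightarrow> bool" where
  "k_complement Eta A B k U \<longleftrightarrow> k \<le> witt_index B \<and> hyperbolic_complement 1 k B U"
| "k_complement Zeta A B k U \<longleftrightarrow> 2 * k \<le> dim_row A \<and> hyperbolic_complement (- 1) k A U"

datatype row = Top | Bottom

text \<open>Lusztig's data of an irreducible representation: a representative of the semisimple class,
  the symbol of the altered factor of the unipotent part, the row of that symbol to which the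
  eta (zeta) construction appends (this is determined by the sign data), and everything else.\<close>

datatype ('f, 'd) lusztig_datum =
  Lusztig_Datum (ss_part: "'f mat") (altered: symbol) (append_row: row) (other_data: 'd)

definition top_arranged :: "('f, 'd) lusztig_datum \<Rightarrow> symbol" where
  "top_arranged D = (case append_row D of Top \<Rightarrow> altered D | Bottom \<Rightarrow> prod.swap (altered D))"

text \<open>The form preserved by the dual group of the identity component of \<open>O(W[-k])\<close> resp.
  \<open>Sp(V[-k])\<close>; even special orthogonal groups are self-dual. The number \<open>w\<close> is \<open>dim W\<close>.\<close>

definition dual_gram :: "side \<Rightarrow> nat \<Rightarrow> 'f::field mat \<Rightarrow> 'f mat" where
  "dual_gram sd w U =
     (case sd of
        Eta \<Rightarrow> if odd w then cls_gram TypeC (dim_row U div 2) else U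
      | Zeta \<Rightarrow> cls_gram TypeB (dim_row U div 2))"

definition semisimple_mat :: "'f::field mat \<Rightarrow> bool" where
  "semisimple_mat s \<longleftrightarrow> (\<exists>D. diagonal_mat D \<and> similar_mat (map_mat to_ac s) D)"

text \<open>Rank and type of the altered factor: the factor of the centralizer of \<open>s\<close> at the
  eigenvalue \<open>e = (- 1)\<^sup>w\<close> is the isometry group of the \<open>e\<close>-eigenspace of \<open>s\<close>, whose dual is
  of type B, C, D, 2D if this factor is symplectic, odd orthogonal, split even orthogonal,
  non-split even orthogonal respectively.\<close>

definition altered_rank :: "nat \<Rightarrow> 'f::field mat \<Rightarrow> nat" where
  "altered_rank w s = Polynomial.order ((- 1) ^ w) (char_poly s) div 2"

definition split_eigenspace :: "nat \<Rightarrow> 'f::field mat \<Rightarrow> 'f mat \<Rightarrow> bool" where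
  "split_eigenspace w J s \<longleftrightarrow>
     (\<exists>Y. isotropic_basis J (altered_rank w s) Y \<and> s * Y = (- 1) ^ w \<cdot>\<^sub>m Y)"

definition altered_type :: "side \<Rightarrow> nat \<Rightarrow> 'f::field mat \<Rightarrow> 'f mat \<Rightarrow> cls_type" where
  "altered_type sd w U s =
     (let even_type = (if split_eigenspace w (dual_gram sd w U) s then TypeD else Type2D)
      in case sd of
           Eta \<Rightarrow> if odd w then TypeB else even_type
         | Zeta \<Rightarrow> if odd w then even_type else TypeC)"

text \<open>Lusztig's parametrization is used only through the shape of its data.\<close>

definition lusztig_parametrization ::
    "side \<Rightarrow> nat \<Rightarrow> 'f::field mat \<Rightarrow> (('f mat \<Rightarrow> complex) \<Rightarrow> ('f, 'd) lusztig_datum) \<Rightarrow> bool" where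
  "lusztig_parametrization sd w U L \<longleftrightarrow>
     inj_on L (irr_chars (isom_group U)) \<and>
     (\<forall>\<rho>\<in>irr_chars (isom_group U).
        let J = dual_gram sd w U; s = ss_part (L \<rho>);
            G' = (if sd = Eta \<and> odd w then isom_group J else special_isom_group J)
        in s \<in> carrier G' \<and> semisimple_mat s \<and>
           altered (L \<rho>) \<in> symbols (altered_type sd w U s) (altered_rank w s))"

text \<open>The coordinate \<open>N'\<close>, with \<open>n\<close> the sum \<open>a + b\<close> of the row lengths of the altered symbol.
  In the symplectic ranges it is \<open>N - (m - k) + \<dots>\<close>, in the orthogonal ones \<open>m - (N - k) + \<dots>\<close>.\<close>

definition new_coord :: "side \<Rightarrow> 'f::field mat \<Rightarrow> 'f mat \<Rightarrow> nat \<Rightarrow> nat \<Rightarrow> int" where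
  "new_coord sd A B k n =
     (let N = int (dim_row A div 2); m = int (dim_row B div 2); w = dim_row B
      in case sd of
           Eta \<Rightarrow> N - (m - int k) + (if odd w then (int n - 1) div 2 else int n div 2)
         | Zeta \<Rightarrow> m - (N - int k) + (if odd w then int n div 2 else (int n - 1) div 2))"

text \<open>Omission of the \<open>i\<close>-th entry, counted from 1.\<close>

definition omit_entry :: "nat \<Rightarrow> 'a list \<Rightarrow> 'a list" where
  "omit_entry i xs = take (i - 1) xs @ drop i xs"

end

theory Submission
  imports Defs "Jordan_Normal_Form.Spectral_Radius"
begin

text \<open>
  By the branching rule each induced representation is the sum of the symbols obtained by adding
  horizontal strips to the two rows, so the identity is one between signed sums of symbols. Let \<open>p\<close> be
  the partition of the extended row \<open>\<lambda>\<^sub>1 < \<dots> < \<lambda>\<^sub>a < N'\<close>, with parts \<open>p\<^sub>0 \<ge> p\<^sub>1 \<ge> \<dots>\<close>. Omitting the entry at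
  position \<open>d\<close> from the top leaves the partition \<open>p\<^sub>0 + 1, \<dots>, p\<^sub>d\<^sub>-\<^sub>1 + 1, p\<^sub>d\<^sub>+\<^sub>1, p\<^sub>d\<^sub>+\<^sub>2, \<dots>\<close>, and a
  partition \<open>q\<close> arises from it by a horizontal strip if and only if the two sequences interlace.
  The strip sizes \<open>k\<^sup>(\<^sup>i\<^sup>)\<close> are chosen such that all terms produce symbols with the same number of cells.

  The symbols of the \<open>d\<close>-th term are divided into those with \<open>q\<^sub>d \<le> p\<^sub>d\<close>, called level \<open>d\<close>, and the others.
  The key point (\<open>omitted_exchange\<close>) is that the others are exactly level \<open>d + 1\<close>. Hence the alternating
  sum telescopes (\<open>alternating_strip_sum\<close>) to level 0, where \<open>q\<^sub>0 \<le> p\<^sub>0\<close> is the bound on the last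
  entry in the theorem, and to the level after the last term. The latter is empty by counting
  cells (\<open>level_empty\<close>, \<open>level_beyond_row_empty\<close>): if the sum was cut off at \<open>i\<^sub>0\<close> because the next
  \<open>k\<^sup>(\<^sup>i\<^sup>)\<close> is negative, the partition is too large already, and if the row is exhausted, the inequality
  \<open>k \<le> N'\<close> of the stable and metastable ranges leaves no room.

  That the right hand side may be described by constituents of the representation induced from \<open>P\<^sub>k\<close>
  needs the orthogonality of irreducible characters (\<open>char_inner_irr_chars\<close>), which is deduced from
  Schur's lemma, and the fact that the classical groups at hand are finite groups
  (\<open>group_cls_group\<close>), which rests on the non-degeneracy of their Gram matrices.
\<close>

section \<open>Schur orthogonality\<close>

definition mat_trace :: "'a::comm_ring_1 mat \<Rightarrow> 'a" where
  "mat_trace M = (\<Sum>i<dim_row M. M $$ (i, i))"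

lemma index_mult_mat_sum:
  assumes "M \<in> carrier_mat n l" "P \<in> carrier_mat l m" "i < n" "j < m"
  shows "(M * P) $$ (i, j) = (\<Sum>x<l. M $$ (i, x) * P $$ (x, j))"
  using assms by (auto simp: scalar_prod_def atLeast0LessThan)

lemma mat_trace_commute:
  assumes M: "M \<in> carrier_mat n m" and P: "P \<in> carrier_mat m n"
  shows "mat_trace (M * P) = mat_trace (P * M)"
proof -
  have "mat_trace (M * P) = (\<Sum>i<n. \<Sum>x<m. M $$ (i, x) * P $$ (x, i))"
    using M P by (simp add: mat_trace_def index_mult_mat_sum[OF M P] del: index_mult_mat(1))
  also have "\<dots> = (\<Sum>x<m. \<Sum>i<n. P $$ (x, i) * M $$ (i, x))"
    by (subst sum.swap) (simp add: mult.commute)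
  also have "\<dots> = mat_trace (P * M)"
    using M P by (simp add: mat_trace_def index_mult_mat_sum[OF P M] del: index_mult_mat(1))
  finally show ?thesis .
qed

lemma irreducible_repD:
  assumes "irreducible_rep G n R"
  shows "n > 0"
    and "g \<in> carrier G \<Longrightarrow> R g \<in> carrier_mat n n"
    and "g \<in> carrier G \<Longrightarrow> h \<in> carrier G \<Longrightarrow> R (g \<otimes>\<^bsub>G\<^esub> h) = R g * R h"
  using assms by (auto simp: irreducible_rep_def hom_def GL_group_def)

text \<open>Homomorphisms into \<open>GL_group n\<close> are only known to be multiplicative; the image of
  the identity is an invertible idempotent.\<close>

lemma irreducible_rep_one:
  assumes irr: "irreducible_rep G n R" and G: "group G"
  shows "R \<one>\<^bsub>G\<^esub> = 1\<^sub>m n"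
proof -
  interpret group G by (rule G)
  have c: "R \<one>\<^bsub>G\<^esub> \<in> carrier_mat n n" and d: "det (R \<one>\<^bsub>G\<^esub>) \<noteq> 0"
    using irr by (auto simp: irreducible_rep_def hom_def GL_group_def)
  have idem: "R \<one>\<^bsub>G\<^esub> * R \<one>\<^bsub>G\<^esub> = R \<one>\<^bsub>G\<^esub>"
    using irreducible_repD(3)[OF irr, of "\<one>\<^bsub>G\<^esub>" "\<one>\<^bsub>G\<^esub>"] by simp
  obtain Y where Y: "Y \<in> carrier_mat n n" "Y * R \<one>\<^bsub>G\<^esub> = 1\<^sub>m n"
    using det_non_zero_imp_unit[OF c d, of "()"] by (auto simp: Units_def ring_mat_def)
  have "R \<one>\<^bsub>G\<^esub> = (Y * R \<one>\<^bsub>G\<^esub>) * R \<one>\<^bsub>G\<^esub>"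
    using Y c by simp
  also have "\<dots> = Y * (R \<one>\<^bsub>G\<^esub> * R \<one>\<^bsub>G\<^esub>)"
    by (rule assoc_mult_mat[OF Y(1) c c])
  finally show ?thesis using idem Y by simp
qed

lemma irreducible_repD_subspace:
  assumes "irreducible_rep G n R" and "S \<subseteq> carrier_vec n" and "0\<^sub>v n \<in> S"
    and "\<And>u v. u \<in> S \<Longrightarrow> v \<in> S \<Longrightarrow> u + v \<in> S"
    and "\<And>c v. v \<in> S \<Longrightarrow> c \<cdot>\<^sub>v v \<in> S"
    and "\<And>g v. g \<in> carrier G \<Longrightarrow> v \<in> S \<Longrightarrow> R g *\<^sub>v v \<in> S"
  shows "S = {0\<^sub>v n} \<or> S = carrier_vec n"
proof -
  have "\<forall>S \<subseteq> carrier_vec n.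
        0\<^sub>v n \<in> S \<and> (\<forall>u\<in>S. \<forall>v\<in>S. u + v \<in> S) \<and> (\<forall>c. \<forall>v\<in>S. c \<cdot>\<^sub>v v \<in> S) \<and>
        (\<forall>g\<in>carrier G. \<forall>v\<in>S. R g *\<^sub>v v \<in> S)
        \<longrightarrow> S = {0\<^sub>v n} \<or> S = carrier_vec n"
    using assms(1) unfolding irreducible_rep_def by (elim conjE)
  from this[rule_format, OF assms(2)] show ?thesis
    using assms(3-) by blast
qed

definition intertwines ::
    "('g, 'x) monoid_scheme \<Rightarrow> nat \<Rightarrow> ('g \<Rightarrow> complex mat) \<Rightarrow> nat \<Rightarrow> ('g \<Rightarrow> complex mat) \<Rightarrow> complex mat \<Rightarrow> bool"
  where "intertwines G n R m S T \<longleftrightarrow>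
     T \<in> carrier_mat n m \<and> (\<forall>g\<in>carrier G. R g * T = T * S g)"

lemma intertwiner_kernel:
  assumes S: "irreducible_rep G m S" and T: "intertwines G n R m S T"
    and R: "\<And>g. g \<in> carrier G \<Longrightarrow> R g \<in> carrier_mat n n"
  shows "{v \<in> carrier_vec m. T *\<^sub>v v = 0\<^sub>v n} = {0\<^sub>v m} \<or>
         {v \<in> carrier_vec m. T *\<^sub>v v = 0\<^sub>v n} = carrier_vec m"
proof (rule irreducible_repD_subspace[OF S])
  have Tc: "T \<in> carrier_mat n m" using T by (simp add: intertwines_def)
  let ?K = "{v \<in> carrier_vec m. T *\<^sub>v v = 0\<^sub>v n}"
  show "?K \<subseteq> carrier_vec m" by auto
  show "0\<^sub>v m \<in> ?K" using Tc by auto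
  show "u + v \<in> ?K" if "u \<in> ?K" "v \<in> ?K" for u v
    using that Tc by (auto simp: mult_add_distrib_mat_vec[OF Tc])
  show "c \<cdot>\<^sub>v v \<in> ?K" if "v \<in> ?K" for c v
    using that Tc by (auto simp: mult_mat_vec[OF Tc])
  show "S g *\<^sub>v v \<in> ?K" if g: "g \<in> carrier G" and v: "v \<in> ?K" for g v
  proof -
    have Sg: "S g \<in> carrier_mat m m" and Rg: "R g \<in> carrier_mat n n"
      using irreducible_repD(2)[OF S g] R[OF g] by blast+
    have "T *\<^sub>v (S g *\<^sub>v v) = (T * S g) *\<^sub>v v"
      using assoc_mult_mat_vec[OF Tc Sg] v by simp
    also have "\<dots> = (R g * T) *\<^sub>v v"
      using T g by (simp add: intertwines_def)
    also have "\<dots> = R g *\<^sub>v (T *\<^sub>v v)"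
      using assoc_mult_mat_vec[OF Rg Tc] v by simp
    also have "\<dots> = 0\<^sub>v n" using v Rg by auto
    finally show ?thesis using Sg v by auto
  qed
qed

lemma intertwiner_image:
  assumes R: "irreducible_rep G n R" and T: "intertwines G n R m S T"
    and S: "\<And>g. g \<in> carrier G \<Longrightarrow> S g \<in> carrier_mat m m"
  shows "(\<lambda>v. T *\<^sub>v v) ` carrier_vec m = {0\<^sub>v n} \<or>
         (\<lambda>v. T *\<^sub>v v) ` carrier_vec m = carrier_vec n"
proof (rule irreducible_repD_subspace[OF R])
  have Tc: "T \<in> carrier_mat n m" using T by (simp add: intertwines_def)
  let ?I = "(\<lambda>v. T *\<^sub>v v) ` carrier_vec m"
  show "?I \<subseteq> carrier_vec n" using Tc by auto
  have "0\<^sub>v n = T *\<^sub>v 0\<^sub>v m" using Tc by auto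
  then show "0\<^sub>v n \<in> ?I" by (rule image_eqI) auto
  show "u + v \<in> ?I" if "u \<in> ?I" "v \<in> ?I" for u v
    using that by (auto simp: mult_add_distrib_mat_vec[OF Tc, symmetric])
  show "c \<cdot>\<^sub>v v \<in> ?I" if "v \<in> ?I" for c v
    using that by (auto simp: mult_mat_vec[OF Tc, symmetric])
  show "R g *\<^sub>v v \<in> ?I" if g: "g \<in> carrier G" and v: "v \<in> ?I" for g v
  proof -
    obtain x where x: "x \<in> carrier_vec m" "v = T *\<^sub>v x" using v by auto
    have Sg: "S g \<in> carrier_mat m m" and Rg: "R g \<in> carrier_mat n n"
      using irreducible_repD(2)[OF R g] S[OF g] by blast+
    have "R g *\<^sub>v v = (R g * T) *\<^sub>v x"
      using assoc_mult_mat_vec[OF Rg Tc] x by simp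
    also have "\<dots> = (T * S g) *\<^sub>v x"
      using T g by (simp add: intertwines_def)
    also have "\<dots> = T *\<^sub>v (S g *\<^sub>v x)"
      using assoc_mult_mat_vec[OF Tc Sg] x by simp
    finally show ?thesis using x Sg by auto
  qed
qed

lemma mat_eq_zeroI:
  assumes T: "(T :: 'a :: comm_ring_1 mat) \<in> carrier_mat n m" and "\<And>v. v \<in> carrier_vec m \<Longrightarrow> T *\<^sub>v v = 0\<^sub>v n"
  shows "T = 0\<^sub>m n m"
proof (rule eq_matI)
  fix i j assume ij: "i < dim_row (0\<^sub>m n m :: 'a mat)" "j < dim_col (0\<^sub>m n m :: 'a mat)"
  have "T *\<^sub>v unit_vec m j = col T j"
    using T ij by (auto intro!: eq_vecI)
  moreover have "T *\<^sub>v unit_vec m j = 0\<^sub>v n" using assms(2) by simp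
  ultimately have "col T j $ i = 0\<^sub>v n $ i" by simp
  then show "T $$ (i, j) = 0\<^sub>m n m $$ (i, j)" using ij T by simp
qed (use T in auto)

lemma mat_minus_eq_zeroD:
  assumes eq: "M - P = 0\<^sub>m n m" and M: "(M :: 'a :: ring mat) \<in> carrier_mat n m"
    and P: "P \<in> carrier_mat n m"
  shows "M = P"
proof (rule eq_matI)
  fix i j assume "i < dim_row P" "j < dim_col P"
  then show "M $$ (i, j) = P $$ (i, j)"
    using M P arg_cong[OF eq, of "\<lambda>Q. Q $$ (i, j)"] by auto
qed (use M P in auto)

text \<open>Schur's lemma. Surjectivity of \<open>T\<close> supplies a right inverse, injectivity makes it a
  left inverse as well, and the trace does not see the conjugation by \<open>T\<close>; so the
  dimensions need not be compared.\<close>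

lemma intertwiner_nonzero_imp_same_trace:
  assumes R: "irreducible_rep G n R" and S: "irreducible_rep G m S"
    and T: "intertwines G n R m S T" and nz: "T \<noteq> 0\<^sub>m n m"
    and g: "g \<in> carrier G"
  shows "mat_trace (R g) = mat_trace (S g)"
proof -
  have Tc: "T \<in> carrier_mat n m" using T by (simp add: intertwines_def)
  note Rg = irreducible_repD(2)[OF R g] and Sg = irreducible_repD(2)[OF S g]
  obtain v0 where v0: "v0 \<in> carrier_vec m" "T *\<^sub>v v0 \<noteq> 0\<^sub>v n"
    using mat_eq_zeroI[OF Tc] nz by blast
  have "{v \<in> carrier_vec m. T *\<^sub>v v = 0\<^sub>v n} \<noteq> carrier_vec m"
    using v0 by blast
  then have inj: "\<And>v. v \<in> carrier_vec m \<Longrightarrow> T *\<^sub>v v = 0\<^sub>v n \<Longrightarrow> v = 0\<^sub>v m"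
    using intertwiner_kernel[OF S T irreducible_repD(2)[OF R]] by blast
  have "(\<lambda>v. T *\<^sub>v v) ` carrier_vec m \<noteq> {0\<^sub>v n}"
    using v0 by blast
  then have surj: "(\<lambda>v. T *\<^sub>v v) ` carrier_vec m = carrier_vec n"
    using intertwiner_image[OF R T irreducible_repD(2)[OF S]] by blast
  have "\<exists>y. y \<in> carrier_vec m \<and> T *\<^sub>v y = unit_vec n j" for j
  proof -
    have "unit_vec n j \<in> (\<lambda>v. T *\<^sub>v v) ` carrier_vec m"
      unfolding surj by simp
    then show ?thesis by force
  qed
  then obtain y where y: "\<And>j. y j \<in> carrier_vec m" "\<And>j. T *\<^sub>v y j = unit_vec n j"
    by metis
  define Y where "Y = mat m n (\<lambda>(i, j). y j $ i)"
  have Yc: "Y \<in> carrier_mat m n" by (simp add: Y_def)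
  have TY: "T * Y = 1\<^sub>m n"
  proof (rule eq_matI)
    fix i j assume "i < dim_row (1\<^sub>m n :: complex mat)" "j < dim_col (1\<^sub>m n :: complex mat)"
    then have ij: "i < n" "j < n" by auto
    have "col Y j = y j" using y(1)[of j] ij by (auto simp: Y_def)
    then have "(T * Y) $$ (i, j) = (T *\<^sub>v y j) $ i"
      using ij Tc Yc by simp
    then show "(T * Y) $$ (i, j) = 1\<^sub>m n $$ (i, j)"
      using y(2)[of j] ij by simp
  qed (use Tc Yc in auto)
  have YTc: "Y * T \<in> carrier_mat m m" using Yc Tc by auto
  have "Y * T - 1\<^sub>m m = 0\<^sub>m m m"
  proof (rule mat_eq_zeroI)
    show "Y * T - 1\<^sub>m m \<in> carrier_mat m m" using YTc by auto
    fix v :: "complex vec" assume v: "v \<in> carrier_vec m"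
    have w: "Y *\<^sub>v (T *\<^sub>v v) - v \<in> carrier_vec m" using v Yc Tc by (intro minus_carrier_vec mult_mat_vec_carrier) auto
    have "T *\<^sub>v (Y *\<^sub>v (T *\<^sub>v v) - v) = T *\<^sub>v (Y *\<^sub>v (T *\<^sub>v v)) - T *\<^sub>v v"
      using v Tc Yc by (intro mult_minus_distrib_mat_vec[OF Tc]) auto
    also have "T *\<^sub>v (Y *\<^sub>v (T *\<^sub>v v)) = (T * Y) *\<^sub>v (T *\<^sub>v v)"
      using v Tc Yc by (intro assoc_mult_mat_vec[symmetric]) auto
    also have "\<dots> = T *\<^sub>v v" using TY Tc v by auto
    also have "T *\<^sub>v v - T *\<^sub>v v = 0\<^sub>v n" using Tc v by auto
    finally have 0: "Y *\<^sub>v (T *\<^sub>v v) - v = 0\<^sub>v m" using inj[OF w] by simp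
    have "(Y * T - 1\<^sub>m m) *\<^sub>v v = (Y * T) *\<^sub>v v - 1\<^sub>m m *\<^sub>v v"
      using v YTc by (intro minus_mult_distrib_mat_vec) auto
    also have "\<dots> = Y *\<^sub>v (T *\<^sub>v v) - v"
      using v assoc_mult_mat_vec[OF Yc Tc v] by simp
    finally show "(Y * T - 1\<^sub>m m) *\<^sub>v v = 0\<^sub>v m" using 0 by simp
  qed
  then have YT: "Y * T = 1\<^sub>m m"
    by (rule mat_minus_eq_zeroD[OF _ YTc one_carrier_mat])
  have "mat_trace (R g) = mat_trace (R g * (T * Y))" using TY Rg by simp
  also have "\<dots> = mat_trace (T * (S g * Y))"
    using T g assoc_mult_mat[OF Rg Tc Yc] assoc_mult_mat[OF Tc Sg Yc]
    by (simp add: intertwines_def)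
  also have "\<dots> = mat_trace ((S g * Y) * T)"
    using Tc Sg Yc by (intro mat_trace_commute[where n = n and m = m]) auto
  also have "\<dots> = mat_trace (S g)"
    using assoc_mult_mat[OF Sg Yc Tc] YT Sg by simp
  finally show ?thesis .
qed

text \<open>Subtracting from \<open>T\<close> an eigenvalue times the identity gives an intertwiner with a
  non-zero kernel, and by irreducibility this kernel is everything.\<close>

lemma self_intertwiner_scalar:
  assumes R: "irreducible_rep G n R" and T: "intertwines G n R n R T"
  shows "\<exists>c. T = c \<cdot>\<^sub>m 1\<^sub>m n"
proof -
  have Tc: "T \<in> carrier_mat n n" using T by (simp add: intertwines_def)
  note Rc = irreducible_repD(2)[OF R]
  obtain c where "c \<in> spectrum T"
    using spectrum_non_empty[OF Tc irreducible_repD(1)[OF R]] by auto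
  then obtain v where v: "v \<in> carrier_vec n" "v \<noteq> 0\<^sub>v n" "T *\<^sub>v v = c \<cdot>\<^sub>v v"
    using Tc by (auto simp: spectrum_def eigenvalue_def eigenvector_def)
  define D where "D = T - c \<cdot>\<^sub>m 1\<^sub>m n"
  have Dc: "D \<in> carrier_mat n n" unfolding D_def by (rule minus_carrier_mat) simp
  have D: "intertwines G n R n R D"
    unfolding intertwines_def
  proof (intro conjI ballI Dc)
    fix g assume g: "g \<in> carrier G"
    have "R g * D = R g * T - R g * (c \<cdot>\<^sub>m 1\<^sub>m n)"
      unfolding D_def by (rule mult_minus_distrib_mat[OF Rc[OF g] Tc]) auto
    also have "R g * (c \<cdot>\<^sub>m 1\<^sub>m n) = (c \<cdot>\<^sub>m 1\<^sub>m n) * R g"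
      using Rc[OF g] by (simp add: mult_smult_distrib[OF Rc[OF g] one_carrier_mat]
          mult_smult_assoc_mat[OF one_carrier_mat Rc[OF g]])
    also have "R g * T - (c \<cdot>\<^sub>m 1\<^sub>m n) * R g = D * R g"
      using T g unfolding D_def intertwines_def
      by (subst minus_mult_distrib_mat[OF Tc _ Rc[OF g]]) auto
    finally show "R g * D = D * R g" .
  qed
  have "D *\<^sub>v v = T *\<^sub>v v - (c \<cdot>\<^sub>m 1\<^sub>m n) *\<^sub>v v"
    unfolding D_def using Tc v by (intro minus_mult_distrib_mat_vec) auto
  also have "\<dots> = 0\<^sub>v n"
    using v by (auto intro!: eq_vecI)
  finally have "{x \<in> carrier_vec n. D *\<^sub>v x = 0\<^sub>v n} \<noteq> {0\<^sub>v n}"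
    using v by blast
  then have "{x \<in> carrier_vec n. D *\<^sub>v x = 0\<^sub>v n} = carrier_vec n"
    using intertwiner_kernel[OF R D Rc] by blast
  then have "D = 0\<^sub>m n n" by (intro mat_eq_zeroI[OF Dc]) blast
  then have "T = c \<cdot>\<^sub>m 1\<^sub>m n"
    unfolding D_def by (rule mat_minus_eq_zeroD[OF _ Tc]) simp
  then show ?thesis by blast
qed

text \<open>Averaging the matrix unit at \<open>(a, b)\<close> over the group produces an intertwiner; its
  entries are the sums that occur in the orthogonality relations.\<close>

definition averaged_unit ::
    "('g, 'x) monoid_scheme \<Rightarrow> nat \<Rightarrow> ('g \<Rightarrow> complex mat) \<Rightarrow> nat \<Rightarrow> ('g \<Rightarrow> complex mat) \<Rightarrow> nat \<Rightarrow> nat \<Rightarrow> complex mat"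
  where "averaged_unit G n R m S a b =
     mat n m (\<lambda>(i, j). \<Sum>g\<in>carrier G. R (inv\<^bsub>G\<^esub> g) $$ (i, a) * S g $$ (b, j))"

lemma intertwines_averaged_unit:
  assumes G: "group G" and R: "irreducible_rep G n R" and S: "irreducible_rep G m S"
    and ab: "a < n" "b < m"
  shows "intertwines G n R m S (averaged_unit G n R m S a b)"
  unfolding intertwines_def
proof (intro conjI ballI)
  let ?T = "averaged_unit G n R m S a b"
  interpret group G by (rule G)
  show Tc: "?T \<in> carrier_mat n m" by (simp add: averaged_unit_def)
  fix h assume h: "h \<in> carrier G"
  note Rc = irreducible_repD(2)[OF R] and Sc = irreducible_repD(2)[OF S]
  show "R h * ?T = ?T * S h"
  proof (rule eq_matI)
    fix i j assume "i < dim_row (?T * S h)" "j < dim_col (?T * S h)"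
    then have ij: "i < n" "j < m" using Tc Sc[OF h] by auto
    have "(R h * ?T) $$ (i, j) =
        (\<Sum>x<n. R h $$ (i, x) * (\<Sum>g\<in>carrier G. R (inv\<^bsub>G\<^esub> g) $$ (x, a) * S g $$ (b, j)))"
      using ij by (subst index_mult_mat_sum[OF Rc[OF h] Tc]) (auto simp: averaged_unit_def)
    also have "\<dots> = (\<Sum>g\<in>carrier G. (\<Sum>x<n. R h $$ (i, x) * R (inv\<^bsub>G\<^esub> g) $$ (x, a)) * S g $$ (b, j))"
      unfolding sum_distrib_left sum_distrib_right by (subst sum.swap) (simp add: mult.assoc)
    also have "\<dots> = (\<Sum>g\<in>carrier G. R (h \<otimes>\<^bsub>G\<^esub> inv\<^bsub>G\<^esub> g) $$ (i, a) * S g $$ (b, j))"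
      using ij ab h
      by (intro sum.cong refl)
        (simp add: irreducible_repD(3)[OF R] index_mult_mat_sum[OF Rc Rc])
    \<comment> \<open>substitute \<open>g \<otimes> h\<close> for \<open>g\<close>\<close>
    also have "\<dots> = (\<Sum>g\<in>carrier G. R (inv\<^bsub>G\<^esub> g) $$ (i, a) * S (g \<otimes>\<^bsub>G\<^esub> h) $$ (b, j))"
    proof (rule sum.reindex_bij_witness[where j = "\<lambda>g. g \<otimes>\<^bsub>G\<^esub> inv\<^bsub>G\<^esub> h" and i = "\<lambda>g. g \<otimes>\<^bsub>G\<^esub> h"])
      fix g assume g: "g \<in> carrier G"
      show "g \<otimes>\<^bsub>G\<^esub> inv\<^bsub>G\<^esub> h \<otimes>\<^bsub>G\<^esub> h = g" "g \<otimes>\<^bsub>G\<^esub> h \<otimes>\<^bsub>G\<^esub> inv\<^bsub>G\<^esub> h = g"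
        using g h by (simp_all add: m_assoc)
      show "R (inv\<^bsub>G\<^esub> (g \<otimes>\<^bsub>G\<^esub> inv\<^bsub>G\<^esub> h)) $$ (i, a) * S (g \<otimes>\<^bsub>G\<^esub> inv\<^bsub>G\<^esub> h \<otimes>\<^bsub>G\<^esub> h) $$ (b, j) =
          R (h \<otimes>\<^bsub>G\<^esub> inv\<^bsub>G\<^esub> g) $$ (i, a) * S g $$ (b, j)"
        using g h by (simp add: inv_mult_group m_assoc)
    qed (use h in auto)
    also have "\<dots> = (\<Sum>g\<in>carrier G. R (inv\<^bsub>G\<^esub> g) $$ (i, a) * (\<Sum>x<m. S g $$ (b, x) * S h $$ (x, j)))"
      using ij ab h
      by (intro sum.cong refl)
        (simp add: irreducible_repD(3)[OF S] index_mult_mat_sum[OF Sc Sc])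
    also have "\<dots> = (\<Sum>x<m. (\<Sum>g\<in>carrier G. R (inv\<^bsub>G\<^esub> g) $$ (i, a) * S g $$ (b, x)) * S h $$ (x, j))"
      unfolding sum_distrib_left sum_distrib_right by (subst sum.swap) (simp add: mult.assoc)
    also have "\<dots> = (?T * S h) $$ (i, j)"
      using ij by (subst index_mult_mat_sum[OF Tc Sc[OF h]]) (auto simp: averaged_unit_def)
    finally show "(R h * ?T) $$ (i, j) = (?T * S h) $$ (i, j)" .
  qed (use Tc Rc[OF h] Sc[OF h] in auto)
qed

lemma sum_characters_eq_averaged_units:
  assumes "group G" and R: "irreducible_rep G n R" and S: "irreducible_rep G m S"
  shows "(\<Sum>g\<in>carrier G. mat_trace (R (inv\<^bsub>G\<^esub> g)) * mat_trace (S g)) =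
         (\<Sum>i<n. \<Sum>j<m. averaged_unit G n R m S i j $$ (i, j))"
proof -
  interpret group G by fact
  have "(\<Sum>g\<in>carrier G. mat_trace (R (inv\<^bsub>G\<^esub> g)) * mat_trace (S g)) =
      (\<Sum>g\<in>carrier G. \<Sum>i<n. \<Sum>j<m. R (inv\<^bsub>G\<^esub> g) $$ (i, i) * S g $$ (j, j))"
    using irreducible_repD(2)[OF R] irreducible_repD(2)[OF S]
    by (intro sum.cong refl) (simp add: mat_trace_def sum_product carrier_matD(1)[of _ n n] carrier_matD(1)[of _ m m])
  also have "\<dots> = (\<Sum>i<n. \<Sum>g\<in>carrier G. \<Sum>j<m. R (inv\<^bsub>G\<^esub> g) $$ (i, i) * S g $$ (j, j))"
    by (rule sum.swap)
  also have "\<dots> = (\<Sum>i<n. \<Sum>j<m. \<Sum>g\<in>carrier G. R (inv\<^bsub>G\<^esub> g) $$ (i, i) * S g $$ (j, j))"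
    by (intro sum.cong refl sum.swap)
  also have "\<dots> = (\<Sum>i<n. \<Sum>j<m. averaged_unit G n R m S i j $$ (i, j))"
    by (simp add: averaged_unit_def)
  finally show ?thesis .
qed

text \<open>The intertwiner is a scalar, and its trace can be evaluated because the products
  \<open>R g * R (inv g)\<close> appear in it.\<close>

lemma averaged_unit_self:
  assumes G: "group G" and R: "irreducible_rep G n R"
    and ab: "a < n" "b < n"
  shows "of_nat n * averaged_unit G n R n R a b $$ (a, b) =
         (if a = b then of_nat (card (carrier G)) else 0)"
proof -
  interpret group G by (rule G)
  note Rc = irreducible_repD(2)[OF R]
  obtain c where c: "averaged_unit G n R n R a b = c \<cdot>\<^sub>m 1\<^sub>m n"
    using self_intertwiner_scalar[OF R intertwines_averaged_unit[OF G R R ab]] by blast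
  have "of_nat n * c = mat_trace (averaged_unit G n R n R a b)"
    unfolding c by (simp add: mat_trace_def)
  also have "\<dots> = (\<Sum>g\<in>carrier G. \<Sum>i<n. R g $$ (b, i) * R (inv\<^bsub>G\<^esub> g) $$ (i, a))"
    by (subst sum.swap) (simp add: mat_trace_def averaged_unit_def mult.commute)
  also have "\<dots> = (\<Sum>g\<in>carrier G. (R g * R (inv\<^bsub>G\<^esub> g)) $$ (b, a))"
    using ab by (intro sum.cong refl) (simp add: index_mult_mat_sum[OF Rc Rc])
  also have "\<dots> = (\<Sum>g\<in>carrier G. 1\<^sub>m n $$ (b, a))"
    using irreducible_rep_one[OF R G]
    by (intro sum.cong refl) (simp add: irreducible_repD(3)[OF R, symmetric])
  also have "\<dots> = (if a = b then of_nat (card (carrier G)) else 0)"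
    using ab by simp
  finally show ?thesis using ab by (auto simp: c)
qed

text \<open>A product of two characters is a sum of diagonal entries of averaged matrix units. If the
  characters differ, all these intertwiners vanish by Schur's lemma; if they agree, they are scalars
  of known trace.\<close>

theorem char_inner_irr_chars:
  assumes G: "group G" and fin: "finite (carrier G)"
    and \<chi>: "\<chi> \<in> irr_chars G" and \<psi>: "\<psi> \<in> irr_chars G"
  shows "char_inner G \<chi> \<psi> = (if \<chi> = \<psi> then 1 else 0)"
proof -
  interpret group G by (rule G)
  have repr: "\<exists>n R. irreducible_rep G n R \<and> (\<forall>g. \<phi> g = (if g \<in> carrier G then mat_trace (R g) else 0))"
    if \<phi>: "\<phi> \<in> irr_chars G" for \<phi>
  proof -
    obtain n R where R: "irreducible_rep G n R"
      "\<phi> = (\<lambda>g. if g \<in> carrier G then \<Sum>i<n. R g $$ (i, i) else 0)"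
      using \<phi> unfolding irr_chars_def by blast
    have "mat_trace (R g) = (\<Sum>i<n. R g $$ (i, i))" if "g \<in> carrier G" for g
      using irreducible_repD(2)[OF R(1) that] by (simp add: mat_trace_def)
    with R show ?thesis by (intro exI[of _ n] exI[of _ R]) simp
  qed
  obtain n R where R: "irreducible_rep G n R"
    and \<chi>R: "\<And>g. \<chi> g = (if g \<in> carrier G then mat_trace (R g) else 0)"
    using repr[OF \<chi>] by blast
  have card: "card (carrier G) \<noteq> 0"
    using fin by (auto simp: card_eq_0_iff)
  show ?thesis
  proof (cases "\<chi> = \<psi>")
    case True
    have "(\<Sum>g\<in>carrier G. \<chi> (inv\<^bsub>G\<^esub> g) * \<psi> g) =
        (\<Sum>i<n. \<Sum>j<n. averaged_unit G n R n R i j $$ (i, j))"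
      unfolding sum_characters_eq_averaged_units[OF G R R, symmetric]
      using True \<chi>R by (intro sum.cong refl) simp
    then have "of_nat n * (\<Sum>g\<in>carrier G. \<chi> (inv\<^bsub>G\<^esub> g) * \<psi> g) =
        (\<Sum>i<n. \<Sum>j<n. of_nat n * averaged_unit G n R n R i j $$ (i, j))"
      by (simp add: sum_distrib_left)
    also have "\<dots> = (\<Sum>i<n. \<Sum>j<n. if i = j then of_nat (card (carrier G)) else 0)"
      by (intro sum.cong refl averaged_unit_self[OF G R]) auto
    also have "\<dots> = of_nat n * of_nat (card (carrier G))"
      by simp
    finally show ?thesis
      using True card irreducible_repD(1)[OF R] by (simp add: char_inner_def)
  next
    case False
    obtain m S where S: "irreducible_rep G m S"
      and \<psi>S: "\<And>g. \<psi> g = (if g \<in> carrier G then mat_trace (S g) else 0)"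
      using repr[OF \<psi>] by blast
    have zero: "averaged_unit G n R m S i j = 0\<^sub>m n m" if "i < n" "j < m" for i j
    proof (rule ccontr)
      assume nz: "averaged_unit G n R m S i j \<noteq> 0\<^sub>m n m"
      have "\<chi> = \<psi>"
        using intertwiner_nonzero_imp_same_trace[OF R S intertwines_averaged_unit[OF G R S that] nz]
        by (auto simp: \<chi>R \<psi>S)
      with False show False by simp
    qed
    have "(\<Sum>g\<in>carrier G. \<chi> (inv\<^bsub>G\<^esub> g) * \<psi> g) =
        (\<Sum>i<n. \<Sum>j<m. averaged_unit G n R m S i j $$ (i, j))"
      unfolding sum_characters_eq_averaged_units[OF G R S, symmetric]
      using \<chi>R \<psi>S by (intro sum.cong refl) simp
    also have "\<dots> = 0" by (simp add: zero)
    finally show ?thesis using False by (simp add: char_inner_def)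
  qed
qed

section \<open>The classical groups are finite groups\<close>

lemma finite_carrier_mat: "finite (carrier_mat n m :: 'a::finite mat set)"
proof -
  have "carrier_mat n m \<subseteq> (\<lambda>f :: nat \<times> nat \<Rightarrow> 'a. mat n m f) `
      PiE ({..<n} \<times> {..<m}) (\<lambda>_. UNIV)"
  proof
    fix M :: "'a mat" assume M: "M \<in> carrier_mat n m"
    have "M = mat n m (restrict (\<lambda>ij. M $$ ij) ({..<n} \<times> {..<m}))"
      using M by (intro eq_matI) auto
    moreover have "restrict (\<lambda>ij. M $$ ij) ({..<n} \<times> {..<m}) \<in> PiE ({..<n} \<times> {..<m}) (\<lambda>_. UNIV)"
      by (simp add: restrict_PiE_iff)
    ultimately show "M \<in> (\<lambda>f :: nat \<times> nat \<Rightarrow> 'a. mat n m f) ` PiE ({..<n} \<times> {..<m}) (\<lambda>_. UNIV)"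
      by (rule image_eqI)
  qed
  then show ?thesis
    by (rule finite_subset) (intro finite_imageI finite_PiE; simp)
qed

lemma isom_group_inverse:
  fixes J :: "'a::field mat"
  assumes J: "J \<in> carrier_mat n n" and d: "det J \<noteq> 0"
    and g: "g \<in> carrier_mat n n" "transpose_mat g * J * g = J"
  shows "\<exists>h \<in> carrier_mat n n. h * g = 1\<^sub>m n \<and> transpose_mat h * J * h = J \<and> det h * det g = 1"
proof -
  have tg: "transpose_mat g \<in> carrier_mat n n" using g by auto
  have "det (transpose_mat g * J * g) = det g * det J * det g"
    using det_mult[OF mult_carrier_mat[OF tg J] g(1)] det_mult[OF tg J] det_transpose[OF g(1)]
    by simp
  then have dg: "det g \<noteq> 0" using g d by auto
  obtain h where h: "h \<in> carrier_mat n n" "h * g = 1\<^sub>m n" "g * h = 1\<^sub>m n"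
    using det_non_zero_imp_unit[OF g(1) dg, of "()"] by (auto simp: Units_def ring_mat_def)
  have th: "transpose_mat h \<in> carrier_mat n n"
    using h by auto
  have "transpose_mat h * J * h = transpose_mat h * (transpose_mat g * J * g) * h"
    using g by simp
  also have "\<dots> = (transpose_mat h * transpose_mat g) * J * (g * h)"
    using th tg J g(1) h(1)
    by (simp add: assoc_mult_mat[where n\<^sub>1 = n and n\<^sub>2 = n and n\<^sub>3 = n and n\<^sub>4 = n])
  also have "transpose_mat h * transpose_mat g = transpose_mat (g * h)"
    using transpose_mult[OF g(1) h(1)] by simp
  finally have "transpose_mat h * J * h = J" using h J by simp
  moreover have "det h * det g = 1" using det_mult[OF h(1) g(1)] h by simp
  ultimately show ?thesis using h by blast
qed

lemma isom_group_closed: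
  fixes J :: "'a::field mat"
  assumes J: "J \<in> carrier_mat n n"
    and g: "g \<in> carrier_mat n n" "transpose_mat g * J * g = J"
    and h: "h \<in> carrier_mat n n" "transpose_mat h * J * h = J"
  shows "transpose_mat (g * h) * J * (g * h) = J"
proof -
  have th: "transpose_mat h \<in> carrier_mat n n" and tg: "transpose_mat g \<in> carrier_mat n n"
    using h g by auto
  have "transpose_mat (g * h) * J * (g * h) = transpose_mat h * (transpose_mat g * J * g) * h"
    using th tg J g(1) h(1) transpose_mult[OF g(1) h(1)]
    by (simp add: assoc_mult_mat[where n\<^sub>1 = n and n\<^sub>2 = n and n\<^sub>3 = n and n\<^sub>4 = n])
  then show ?thesis using g h by simp
qed

lemma group_isom_group:
  fixes J :: "'a::field mat"
  assumes J: "J \<in> carrier_mat n n" and d: "det J \<noteq> 0"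
  shows "group (isom_group J)" and "group (special_isom_group J)"
proof -
  have n: "dim_row J = n" using J by simp
  show "group (isom_group J)"
  proof (rule groupI)
    fix g assume "g \<in> carrier (isom_group J)"
    then show "\<exists>h\<in>carrier (isom_group J). h \<otimes>\<^bsub>isom_group J\<^esub> g = \<one>\<^bsub>isom_group J\<^esub>"
      using isom_group_inverse[OF J d, of g] by (auto simp: isom_group_def n)
  qed (use J isom_group_closed[OF J] in
      \<open>auto simp: isom_group_def assoc_mult_mat[where n\<^sub>1 = n and n\<^sub>2 = n and n\<^sub>3 = n and n\<^sub>4 = n]\<close>)
  show "group (special_isom_group J)"
  proof (rule groupI)
    fix g assume "g \<in> carrier (special_isom_group J)"
    then show "\<exists>h\<in>carrier (special_isom_group J).
        h \<otimes>\<^bsub>special_isom_group J\<^esub> g = \<one>\<^bsub>special_isom_group J\<^esub>"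
      using isom_group_inverse[OF J d, of g] by (auto simp: special_isom_group_def isom_group_def n)
  qed (use J isom_group_closed[OF J] in
      \<open>auto simp: special_isom_group_def isom_group_def det_mult[where n = n]
        assoc_mult_mat[where n\<^sub>1 = n and n\<^sub>2 = n and n\<^sub>3 = n and n\<^sub>4 = n]\<close>)
qed

text \<open>All Gram matrices of \<open>cls_gram\<close> have one non-zero entry in every row and column.\<close>

lemma det_monomial_mat_nonzero:
  fixes c :: "nat \<Rightarrow> 'a::field"
  assumes \<sigma>: "\<And>i. i < n \<Longrightarrow> \<sigma> i < n" "inj_on \<sigma> {..<n}" and c: "\<And>i. i < n \<Longrightarrow> c i \<noteq> 0"
  shows "det (mat n n (\<lambda>(i, l). if l = \<sigma> i then c i else 0)) \<noteq> 0"
proof -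
  let ?J = "mat n n (\<lambda>(i, l). if l = \<sigma> i then c i else 0)"
  let ?K = "mat n n (\<lambda>(i, l). if i = \<sigma> l then inverse (c l) else 0)"
  have "?J * ?K = 1\<^sub>m n"
  proof (rule eq_matI)
    fix i l assume "i < dim_row (1\<^sub>m n :: 'a mat)" "l < dim_col (1\<^sub>m n :: 'a mat)"
    then have il: "i < n" "l < n" by auto
    have "(?J * ?K) $$ (i, l) = (\<Sum>x<n. ?J $$ (i, x) * ?K $$ (x, l))"
      by (rule index_mult_mat_sum) (use il in auto)
    also have "\<dots> = (\<Sum>x<n. if x = \<sigma> l then (if \<sigma> l = \<sigma> i then c i * inverse (c l) else 0) else 0)"
      using il by (intro sum.cong refl) auto
    also have "\<dots> = (if \<sigma> l = \<sigma> i then c i * inverse (c l) else 0)"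
      using il \<sigma>(1) by simp
    also have "\<dots> = 1\<^sub>m n $$ (i, l)"
      using il c \<sigma>(2) by (auto simp: inj_on_def)
    finally show "(?J * ?K) $$ (i, l) = 1\<^sub>m n $$ (i, l)" .
  qed auto
  then have "det ?J * det ?K = 1"
    using det_mult[of ?J n ?K] by simp
  then show ?thesis by auto
qed

text \<open>Were every element a square, squaring would be injective on the finite field, so that
  \<open>1 = - 1\<close>; but the characteristic of a field of odd order is not 2. A non-square is non-zero, which is what
  the Gram matrix of type 2D requires.\<close>

lemma exists_nonsquare:
  assumes "odd (card (UNIV :: 'a::{field,finite} set))"
  shows "\<exists>e :: 'a. \<nexists>y. y ^ 2 = e"
proof (rule ccontr)
  assume "\<not> ?thesis"
  then have "\<exists>y. y ^ 2 = e" for e :: 'a by blast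
  then have "surj (\<lambda>y :: 'a. y ^ 2)" unfolding surj_def by metis
  then have inj: "inj (\<lambda>y :: 'a. y ^ 2)" by (rule finite_UNIV_surj_inj[OF finite_UNIV])
  have two: "(1 :: 'a) = - 1" by (rule injD[OF inj]) simp
  \<comment> \<open>translation by 1 permutes the field, so the order of the field vanishes in the field\<close>
  have "(\<Sum>x\<in>(UNIV :: 'a set). x) = (\<Sum>x\<in>UNIV. x + 1)"
    by (rule sum.reindex_bij_witness[where i = "\<lambda>x. x + 1" and j = "\<lambda>x. x - 1"]) auto
  then have "(of_nat (card (UNIV :: 'a set)) :: 'a) = 0"
    by (simp add: sum.distrib)
  moreover obtain k where "card (UNIV :: 'a set) = 2 * k + 1"
    using assms by (rule oddE)
  moreover have "(2 :: 'a) = 0"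
    using two by (metis add.right_inverse one_add_one)
  ultimately show False by simp
qed

lemma cls_gram_carrier:
  "(cls_gram t r :: 'a::field mat) \<in>
     carrier_mat (if t = TypeB then 2 * r + 1 else 2 * r) (if t = TypeB then 2 * r + 1 else 2 * r)"
  by (cases t) auto

lemma det_cls_gram_nonzero:
  assumes q: "odd (card (UNIV :: 'a::{field,finite} set))"
  shows "det (cls_gram t r :: 'a mat) \<noteq> 0"
proof (cases t)
  case TypeB
  have eq: "(cls_gram t r :: 'a mat) = mat (2*r+1) (2*r+1) (\<lambda>(i, l). if l = 2 * r - i then 1 else 0)"
    using TypeB by (auto intro!: cong_mat)
  show ?thesis unfolding eq
    by (intro det_monomial_mat_nonzero) (auto simp: inj_on_def)
next
  case TypeC
  have eq: "(cls_gram t r :: 'a mat) =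
      mat (2*r) (2*r) (\<lambda>(i, l). if l = 2 * r - 1 - i then (if i < r then 1 else - 1) else 0)"
    using TypeC by (auto intro!: cong_mat)
  show ?thesis unfolding eq
    by (intro det_monomial_mat_nonzero) (auto simp: inj_on_def)
next
  case TypeD
  have eq: "(cls_gram t r :: 'a mat) =
      mat (2*r) (2*r) (\<lambda>(i, l). if l = 2 * r - 1 - i then 1 else 0)"
    using TypeD by (auto intro!: cong_mat)
  show ?thesis unfolding eq
    by (intro det_monomial_mat_nonzero) (auto simp: inj_on_def)
next
  case Type2D
  define e where "e = (SOME \<epsilon> :: 'a. \<nexists>y. y ^ 2 = \<epsilon>)"
  have "\<nexists>y. y ^ 2 = e"
    unfolding e_def by (rule someI_ex) (rule exists_nonsquare[OF q])
  then have e: "e \<noteq> 0" by (metis zero_power2)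
  \<comment> \<open>the two middle coordinates are fixed, the others are reflected\<close>
  define \<sigma> where "\<sigma> i = (if i + 1 = r \<or> i = r then i else 2 * r - 1 - i)" for i
  have "inj_on \<sigma> {..<2 * r}"
  proof (rule inj_onI)
    fix i l assume "i \<in> {..<2 * r}" "l \<in> {..<2 * r}" "\<sigma> i = \<sigma> l"
    then show "i = l" unfolding \<sigma>_def lessThan_iff by (simp split: if_splits; linarith)
  qed
  note inj = this
  have eq: "(cls_gram t r :: 'a mat) =
      mat (2*r) (2*r) (\<lambda>(i, l). if l = \<sigma> i then (if i = r then - e else 1) else 0)"
  proof (rule eq_matI)
    fix i l assume "i < dim_row (mat (2*r) (2*r) (\<lambda>(i, l). if l = \<sigma> i then (if i = r then - e else 1) else 0))"
      "l < dim_col (mat (2*r) (2*r) (\<lambda>(i, l). if l = \<sigma> i then (if i = r then - e else 1) else 0))"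
    then have il: "i < 2 * r" "l < 2 * r" by auto
    consider "i + 1 = r" | "i = r" | "i + 1 \<noteq> r" "i \<noteq> r" by blast
    then show "(cls_gram t r :: 'a mat) $$ (i, l) =
        mat (2*r) (2*r) (\<lambda>(i, l). if l = \<sigma> i then (if i = r then - e else 1) else 0) $$ (i, l)"
    proof cases
      case 3
      then have "(i + l + 1 = 2 * r) = (l = \<sigma> i)" using il by (auto simp: \<sigma>_def)
      then show ?thesis using 3 il Type2D by simp
    qed (use il Type2D in \<open>auto simp: \<sigma>_def e_def\<close>)
  qed (use Type2D in auto)
  show ?thesis unfolding eq
    by (intro det_monomial_mat_nonzero inj) (use e in \<open>auto simp: \<sigma>_def\<close>)
qed

lemma group_cls_group:
  assumes q: "odd (card (UNIV :: 'a::{field,finite} set))"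
  shows "group (cls_group t r :: 'a mat monoid)"
  using group_isom_group[OF cls_gram_carrier det_cls_gram_nonzero[OF q]]
  by (cases t) (simp_all del: cls_gram.simps)

lemma finite_cls_group: "finite (carrier (cls_group t r :: 'a::{field,finite} mat monoid))"
proof (rule finite_subset[OF _ finite_carrier_mat])
  let ?d = "dim_row (cls_gram t r :: 'a mat)"
  show "carrier (cls_group t r :: 'a mat monoid) \<subseteq> carrier_mat ?d ?d"
    by (cases t) (auto simp: special_isom_group_def isom_group_def)
qed

section \<open>Rows as partitions\<close>

text \<open>The partition of a row as an infinite decreasing sequence, padded by zeros. Rows of
  different lengths can be compared in this form, which matters because adding a strip may lengthen
  the rows of a symbol.\<close>

definition part :: "nat list \<Rightarrow> nat \<Rightarrow> nat" where
  "part ls i = (if i < length ls then rev ls ! i - (length ls - 1 - i) else 0)"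

lemma row_diagram_eq: "row_diagram ls = {(i, c). c < part ls i}"
  by (auto simp: row_diagram_def part_def split: if_splits)

lemma finite_row_diagram: "finite (row_diagram ls)"
proof -
  have "row_diagram ls = Sigma {..<length ls} (\<lambda>i. {..<part ls i})"
    by (auto simp: row_diagram_eq part_def split: if_splits)
  then show ?thesis by simp
qed

lemma row_diagram_subset_iff: "row_diagram ls \<subseteq> row_diagram ls' \<longleftrightarrow> (\<forall>i. part ls i \<le> part ls' i)"
proof
  assume *: "row_diagram ls \<subseteq> row_diagram ls'"
  show "\<forall>i. part ls i \<le> part ls' i"
  proof (rule allI, rule ccontr)
    fix i assume "\<not> part ls i \<le> part ls' i"
    then have "(i, part ls' i) \<in> row_diagram ls" by (simp add: row_diagram_eq)
    with * have "(i, part ls' i) \<in> row_diagram ls'" by blast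
    then show False by (simp add: row_diagram_eq)
  qed
qed (auto simp: row_diagram_eq intro: less_le_trans)

lemma sorted_row_nth_ge:
  assumes "sorted_wrt (<) ls" "i < length ls"
  shows "i \<le> (ls ! i :: nat)"
  using assms(2)
proof (induction i)
  case (Suc i)
  then have "ls ! i < ls ! Suc i"
    using assms(1) by (simp add: sorted_wrt_iff_nth_less)
  with Suc show ?case by simp
qed simp

lemma part_eq:
  assumes "sorted_wrt (<) ls" "i < length ls"
  shows "part ls i + (length ls - 1 - i) = ls ! (length ls - 1 - i)"
proof -
  have "rev ls ! i = ls ! (length ls - 1 - i)" using assms(2) by (simp add: rev_nth)
  moreover have "length ls - 1 - i \<le> ls ! (length ls - 1 - i)"
    by (rule sorted_row_nth_ge[OF assms(1)]) (use assms(2) in simp)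
  ultimately show ?thesis using assms(2) by (simp only: part_def) simp
qed

lemma part_Suc_le:
  assumes ls: "sorted_wrt (<) ls"
  shows "part ls (Suc i) \<le> part ls i"
proof (cases "Suc i < length ls")
  case True
  then have "ls ! (length ls - 1 - Suc i) < ls ! (length ls - 1 - i)"
    using ls by (simp add: sorted_wrt_iff_nth_less)
  then show ?thesis
    using part_eq[OF ls, of i] part_eq[OF ls, of "Suc i"] True by simp
qed (simp add: part_def)

lemma part_antimono:
  assumes "sorted_wrt (<) ls" "i \<le> l"
  shows "part ls l \<le> part ls i"
  using part_Suc_le[OF assms(1)] assms(2) by (rule lift_Suc_antimono_le)

lemma sum_list_row:
  assumes ls: "sorted_wrt (<) ls"
  shows "2 * sum_list ls = 2 * card (row_diagram ls) + length ls * (length ls - 1)"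
proof -
  let ?n = "length ls"
  have "row_diagram ls = Sigma {..<?n} (\<lambda>i. {..<part ls i})"
    by (auto simp: row_diagram_eq part_def split: if_splits)
  then have card: "card (row_diagram ls) = (\<Sum>i<?n. part ls i)" by simp
  have "sum_list ls = (\<Sum>i<?n. ls ! i)"
    by (simp add: sum_list_sum_nth atLeast0LessThan)
  also have "\<dots> = (\<Sum>i<?n. ls ! (?n - 1 - i))"
    by (rule sum.reindex_bij_witness[where i = "\<lambda>i. ?n - 1 - i" and j = "\<lambda>i. ?n - 1 - i"]) auto
  also have "\<dots> = (\<Sum>i<?n. part ls i + (?n - 1 - i))"
    using part_eq[OF ls] by (intro sum.cong refl) simp
  also have "\<dots> = card (row_diagram ls) + (\<Sum>i<?n. ?n - 1 - i)"
    by (simp only: sum.distrib card)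
  also have "(\<Sum>i<?n. ?n - 1 - i) = (\<Sum>i<?n. i)"
    by (rule sum.reindex_bij_witness[where i = "\<lambda>i. ?n - 1 - i" and j = "\<lambda>i. ?n - 1 - i"]) auto
  finally have "2 * sum_list ls = 2 * card (row_diagram ls) + 2 * (\<Sum>i<?n. i)" by simp
  also have "2 * (\<Sum>i<?n. i) = ?n * (?n - 1)"
  proof -
    have "2 * (\<Sum>i<n. i) + n = n * n" for n :: nat by (induction n) auto
    then show ?thesis by (metis diff_add_inverse2 diff_mult_distrib2 mult_1_right)
  qed
  finally show ?thesis .
qed

text \<open>The partition \<open>q\<close> arises from \<open>p\<close> by adding a horizontal strip.\<close>

definition interlaces :: "(nat \<Rightarrow> nat) \<Rightarrow> (nat \<Rightarrow> nat) \<Rightarrow> bool" where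
  "interlaces p q \<longleftrightarrow> (\<forall>i. p i \<le> q i \<and> q (Suc i) \<le> p i)"

text \<open>If \<open>q (Suc i) > p i\<close>, then rows \<open>i\<close> and \<open>Suc i\<close> both receive a box in column \<open>p i\<close>;
  conversely two added boxes in one column violate the inequality at the upper one.\<close>

lemma adds_horizontal_strip_iff:
  assumes ls: "sorted_wrt (<) ls" and ls': "sorted_wrt (<) ls'"
  shows "adds_horizontal_strip n ls ls' \<longleftrightarrow>
     interlaces (part ls) (part ls') \<and> card (row_diagram ls') = card (row_diagram ls) + n"
proof (cases "row_diagram ls \<subseteq> row_diagram ls'")
  case sub: True
  then have le: "\<And>i. part ls i \<le> part ls' i" by (simp add: row_diagram_subset_iff)
  have mem: "(i, c) \<in> row_diagram ls' - row_diagram ls \<longleftrightarrow> part ls i \<le> c \<and> c < part ls' i" for i c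
    by (auto simp: row_diagram_eq)
  have card: "card (row_diagram ls' - row_diagram ls) = n \<longleftrightarrow>
      card (row_diagram ls') = card (row_diagram ls) + n"
    using card_Diff_subset[OF finite_row_diagram sub] card_mono[OF finite_row_diagram sub] by auto
  have "inj_on snd (row_diagram ls' - row_diagram ls) \<longleftrightarrow> (\<forall>i. part ls' (Suc i) \<le> part ls i)"
  proof (intro iffI allI)
    fix i assume inj: "inj_on snd (row_diagram ls' - row_diagram ls)"
    show "part ls' (Suc i) \<le> part ls i"
    proof (rule ccontr)
      assume "\<not> ?thesis"
      then have "(Suc i, part ls i) \<in> row_diagram ls' - row_diagram ls"
        and "(i, part ls i) \<in> row_diagram ls' - row_diagram ls"
        unfolding mem using part_Suc_le[OF ls, of i] part_Suc_le[OF ls', of i] by auto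
      then have "(Suc i, part ls i) = (i, part ls i)"
        by (rule inj_onD[OF inj, rotated 1]) simp
      then show False by simp
    qed
  next
    assume *: "\<forall>i. part ls' (Suc i) \<le> part ls i"
    have "\<not> i < l" if "(i, c) \<in> row_diagram ls' - row_diagram ls"
      "(l, c) \<in> row_diagram ls' - row_diagram ls" for i l c
    proof
      assume "i < l"
      then have "part ls' l \<le> part ls i"
        using part_antimono[OF ls', of "Suc i" l] * by (meson Suc_leI order_trans)
      then show False using that unfolding mem by linarith
    qed
    then show "inj_on snd (row_diagram ls' - row_diagram ls)"
      by (intro inj_onI) (metis linorder_neqE_nat prod.collapse)
  qed
  then show ?thesis
    using sub le card by (auto simp: adds_horizontal_strip_def interlaces_def)
qed (auto simp: adds_horizontal_strip_def interlaces_def row_diagram_subset_iff)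

section \<open>Symbols as pairs of partitions\<close>

definition cells :: "symbol \<Rightarrow> nat" where
  "cells \<Lambda> = card (row_diagram (fst \<Lambda>)) + card (row_diagram (snd \<Lambda>))"

lemma is_symbol_sorted:
  assumes "is_symbol \<Lambda>"
  shows "sorted_wrt (<) (fst \<Lambda>)" "sorted_wrt (<) (snd \<Lambda>)"
  using assms by (cases \<Lambda>; simp)+

lemma mem_strip_symbols_iff:
  assumes \<Lambda>: "is_symbol \<Lambda>"
  shows "\<Lambda>' \<in> strip_symbols j \<Lambda> \<longleftrightarrow>
     is_symbol \<Lambda>' \<and> defect \<Lambda>' = defect \<Lambda> \<and>
     interlaces (part (fst \<Lambda>)) (part (fst \<Lambda>')) \<and> interlaces (part (snd \<Lambda>)) (part (snd \<Lambda>')) \<and>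
     cells \<Lambda>' = cells \<Lambda> + j"
proof (cases "is_symbol \<Lambda>'")
  case True
  have le: "card (row_diagram ls) \<le> card (row_diagram ls')" if "interlaces (part ls) (part ls')" for ls ls'
    using that by (intro card_mono finite_row_diagram) (simp add: row_diagram_subset_iff interlaces_def)
  have "(\<exists>j1 j2. j1 + j2 = j \<and> adds_horizontal_strip j1 (fst \<Lambda>) (fst \<Lambda>') \<and>
                 adds_horizontal_strip j2 (snd \<Lambda>) (snd \<Lambda>')) \<longleftrightarrow>
     interlaces (part (fst \<Lambda>)) (part (fst \<Lambda>')) \<and> interlaces (part (snd \<Lambda>)) (part (snd \<Lambda>')) \<and>
     cells \<Lambda>' = cells \<Lambda> + j" (is "?L \<longleftrightarrow> ?R")
  proof
    assume ?L then show ?R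
      using is_symbol_sorted[OF \<Lambda>] is_symbol_sorted[OF True]
      by (auto simp: adds_horizontal_strip_iff cells_def)
  next
    assume R: ?R
    show ?L
      using R le[of "fst \<Lambda>" "fst \<Lambda>'"] le[of "snd \<Lambda>" "snd \<Lambda>'"]
        is_symbol_sorted[OF \<Lambda>] is_symbol_sorted[OF True]
      by (intro exI[of _ "card (row_diagram (fst \<Lambda>')) - card (row_diagram (fst \<Lambda>))"]
          exI[of _ "card (row_diagram (snd \<Lambda>')) - card (row_diagram (snd \<Lambda>))"])
        (auto simp: adds_horizontal_strip_iff cells_def)
  qed
  then show ?thesis using True by (simp add: strip_symbols_def)
qed (simp add: strip_symbols_def)

text \<open>In the formula for the rank the row lengths only enter through the square of the defect,
  because the triangular numbers coming from the shifts \<open>0, 1, 2, \<dots>\<close> of the entries absorb the rest.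
  This form of membership makes the effect of strips and of omitted entries on the rank visible.\<close>

lemma mem_symbols_iff:
  "\<Lambda> \<in> symbols t r \<longleftrightarrow> is_symbol \<Lambda> \<and>
     (if t = TypeB \<or> t = TypeC then odd (defect \<Lambda>) \<and> 4 * int (cells \<Lambda>) + (defect \<Lambda>)\<^sup>2 = 4 * int r + 1
      else defect \<Lambda> mod 4 = (if t = TypeD then 0 else 2) \<and> 4 * int (cells \<Lambda>) + (defect \<Lambda>)\<^sup>2 = 4 * int r)"
proof (cases "is_symbol \<Lambda>")
  case True
  define a b where "a = length (fst \<Lambda>)" and "b = length (snd \<Lambda>)"
  define s where "s = sum_list (fst \<Lambda>) + sum_list (snd \<Lambda>)"
  have tri: "int (n * (n - 1)) = (int n)\<^sup>2 - int n" for n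
    by (cases n) (auto simp: power2_eq_square algebra_simps)
  have "2 * s = 2 * cells \<Lambda> + a * (a - 1) + b * (b - 1)"
    unfolding cells_def s_def a_def b_def
    by (simp only: distrib_left sum_list_row[OF is_symbol_sorted(1)[OF True]]
        sum_list_row[OF is_symbol_sorted(2)[OF True]] add_ac)
  then have "int (2 * s) = int (2 * cells \<Lambda>) + int (a * (a - 1)) + int (b * (b - 1))"
    by (simp only: of_nat_add)
  then have s: "2 * int s = 2 * int (cells \<Lambda>) + ((int a)\<^sup>2 - int a) + ((int b)\<^sup>2 - int b)"
    unfolding tri by simp
  have d: "defect \<Lambda> = int a - int b" by (simp add: defect_def a_def b_def)
  have odd_case: "s = r + (a + b - 1)\<^sup>2 div 4 \<longleftrightarrow> 4 * int (cells \<Lambda>) + (defect \<Lambda>)\<^sup>2 = 4 * int r + 1"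
    if "odd (defect \<Lambda>)"
  proof -
    have "odd (a + b)" using that unfolding d by presburger
    then obtain h where h: "a + b = 2 * h + 1" by (rule oddE)
    then have ih: "int b = 2 * int h + 1 - int a" by linarith
    have "(a + b - 1)\<^sup>2 div 4 = h\<^sup>2" using h by (simp add: power_mult_distrib)
    then have "s = r + (a + b - 1)\<^sup>2 div 4 \<longleftrightarrow> int s = int r + (int h)\<^sup>2"
      by (metis of_nat_add of_nat_eq_iff of_nat_power)
    also have "\<dots> \<longleftrightarrow> 4 * int (cells \<Lambda>) + (defect \<Lambda>)\<^sup>2 = 4 * int r + 1"
      using s unfolding d ih by (auto simp: power2_eq_square algebra_simps)
    finally show ?thesis .
  qed
  have even_case: "s = r + (a + b) * (a + b - 2) div 4 \<longleftrightarrow> 4 * int (cells \<Lambda>) + (defect \<Lambda>)\<^sup>2 = 4 * int r"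
    if "even (defect \<Lambda>)"
  proof -
    have "even (a + b)" using that unfolding d by presburger
    then obtain h where h: "a + b = 2 * h" by (rule evenE)
    then have ih: "int b = 2 * int h - int a" by linarith
    have "(a + b) * (a + b - 2) = 4 * (h * (h - 1))"
      unfolding h by (cases h) auto
    then have "(a + b) * (a + b - 2) div 4 = h * (h - 1)" by simp
    then have "s = r + (a + b) * (a + b - 2) div 4 \<longleftrightarrow> int s = int r + ((int h)\<^sup>2 - int h)"
      by (metis of_nat_add of_nat_eq_iff tri)
    also have "\<dots> \<longleftrightarrow> 4 * int (cells \<Lambda>) + (defect \<Lambda>)\<^sup>2 = 4 * int r"
      using s unfolding d ih by (auto simp: power2_eq_square algebra_simps)
    finally show ?thesis .
  qed
  have ev: "defect \<Lambda> mod 4 = 0 \<Longrightarrow> even (defect \<Lambda>)" "defect \<Lambda> mod 4 = 2 \<Longrightarrow> even (defect \<Lambda>)"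
    by presburger+
  show ?thesis
    using True odd_case even_case ev
    by (cases t) (auto simp: symbols_def Let_def s_def[symmetric] a_def[symmetric] b_def[symmetric])
qed (simp add: symbols_def)

lemma strip_symbols_subset_symbols:
  assumes "\<Lambda> \<in> symbols t r"
  shows "strip_symbols j \<Lambda> \<subseteq> symbols t (r + j)"
  using assms by (auto simp: mem_symbols_iff mem_strip_symbols_iff split: if_splits)

text \<open>A horizontal strip adds at most one part to a partition. If one row grew by two entries, then
  so would the other, as the defect is fixed, and both rows would begin with 0.\<close>

lemma length_strip_symbols:
  assumes \<Lambda>: "is_symbol \<Lambda>" and \<Lambda>': "\<Lambda>' \<in> strip_symbols j \<Lambda>"
  shows "length (fst \<Lambda>') \<le> length (fst \<Lambda>) + 1 \<and> length (snd \<Lambda>') \<le> length (snd \<Lambda>) + 1"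
proof (rule ccontr)
  assume "\<not> ?thesis"
  moreover have d: "int (length (fst \<Lambda>')) - int (length (snd \<Lambda>')) =
      int (length (fst \<Lambda>)) - int (length (snd \<Lambda>))"
    using \<Lambda>' by (simp add: strip_symbols_def defect_def)
  ultimately have long: "length (fst \<Lambda>') \<ge> length (fst \<Lambda>) + 2" "length (snd \<Lambda>') \<ge> length (snd \<Lambda>) + 2"
    by linarith+
  have sym: "is_symbol \<Lambda>'" using \<Lambda>' by (simp add: strip_symbols_def)
  have "hd ls' = 0" if il: "interlaces (part ls) (part ls')" and len: "length ls' \<ge> length ls + 2"
    and s: "sorted_wrt (<) ls'" for ls ls' :: "nat list"
  proof -
    have "part ls' (Suc (length ls' - 2)) \<le> part ls (length ls' - 2)"
      using il by (simp add: interlaces_def)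
    also have "\<dots> = 0" using len by (simp add: part_def)
    finally have "part ls' (length ls' - 1) = 0"
      using len by (simp add: numeral_2_eq_2 Suc_diff_Suc)
    then show ?thesis
      using part_eq[OF s, of "length ls' - 1"] len by (cases ls') auto
  qed
  from this[OF _ long(1)] this[OF _ long(2)] have "hd (fst \<Lambda>') = 0" "hd (snd \<Lambda>') = 0"
    using \<Lambda>' is_symbol_sorted[OF sym] by (auto simp: mem_strip_symbols_iff[OF \<Lambda>])
  moreover have "fst \<Lambda>' \<noteq> []" "snd \<Lambda>' \<noteq> []" using long by auto
  ultimately show False using sym by (cases \<Lambda>') auto
qed

lemma finite_strip_symbols:
  assumes \<Lambda>: "is_symbol \<Lambda>"
  shows "finite (strip_symbols j \<Lambda>)"
proof -
  define n where "n = length (fst \<Lambda>) + length (snd \<Lambda>) + 1"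
  define B where "B = cells \<Lambda> + j + n * n"
  have bound: "set ls \<subseteq> {..B}" if s: "sorted_wrt (<) ls" and l: "length ls \<le> n"
    and c: "card (row_diagram ls) \<le> cells \<Lambda> + j" for ls
  proof
    fix x assume "x \<in> set ls"
    then have "x \<le> sum_list ls" by (intro member_le_sum_list) auto
    moreover have "length ls * (length ls - 1) \<le> n * n" using l by (intro mult_mono) auto
    ultimately show "x \<in> {..B}" using sum_list_row[OF s] c by (simp add: B_def)
  qed
  have "strip_symbols j \<Lambda> \<subseteq>
      {ls. set ls \<subseteq> {..B} \<and> length ls \<le> n} \<times> {ls. set ls \<subseteq> {..B} \<and> length ls \<le> n}"
  proof
    fix \<Lambda>' assume \<Lambda>': "\<Lambda>' \<in> strip_symbols j \<Lambda>"
    have len: "length (fst \<Lambda>') \<le> n" "length (snd \<Lambda>') \<le> n"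
      using length_strip_symbols[OF \<Lambda> \<Lambda>'] by (auto simp: n_def)
    have "is_symbol \<Lambda>'" "cells \<Lambda>' = cells \<Lambda> + j"
      using \<Lambda>' by (auto simp: mem_strip_symbols_iff[OF \<Lambda>])
    then show "\<Lambda>' \<in> {ls. set ls \<subseteq> {..B} \<and> length ls \<le> n} \<times> {ls. set ls \<subseteq> {..B} \<and> length ls \<le> n}"
      using len bound[OF is_symbol_sorted(1)] bound[OF is_symbol_sorted(2)]
      by (auto simp: mem_Times_iff cells_def)
  qed
  then show ?thesis
    by (rule finite_subset) (intro finite_cartesian_product finite_lists_length_le; simp)
qed

section \<open>The alternating sum over omitted entries\<close>

text \<open>Entries are omitted at position \<open>d\<close> counted from the largest, starting with 0. The \<open>d\<close> larger
  entries lose one smaller neighbour, so their parts grow by 1.\<close>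

lemma part_omit_entry:
  assumes sorted: "sorted_wrt (<) xs" and len: "length xs = Suc a" and d: "d \<le> a"
  shows "sorted_wrt (<) (omit_entry (Suc a - d) xs)"
    and "length (omit_entry (Suc a - d) xs) = a"
    and "sum_list (omit_entry (Suc a - d) xs) + xs ! (a - d) = sum_list xs"
    and "part (omit_entry (Suc a - d) xs) l = (if l < d then part xs l + 1 else part xs (Suc l))"
proof -
  let ?x = "omit_entry (Suc a - d) xs"
  have x: "?x = take (a - d) xs @ drop (Suc (a - d)) xs"
    using d by (simp add: omit_entry_def Suc_diff_le)
  have split: "xs = take (a - d) xs @ xs ! (a - d) # drop (Suc (a - d)) xs"
    by (rule id_take_nth_drop) (use len in simp)
  show sx: "sorted_wrt (<) ?x"
    using sorted by (subst (asm) split) (auto simp: x sorted_wrt_append)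
  show lx: "length ?x = a"
    using len d by (simp add: x)
  have "sum_list (take (a - d) xs @ xs ! (a - d) # drop (Suc (a - d)) xs) = sum_list ?x + xs ! (a - d)"
    by (simp add: x)
  then show "sum_list ?x + xs ! (a - d) = sum_list xs"
    using split by simp
  have nth: "?x ! m = (if m < a - d then xs ! m else xs ! Suc m)" if "m < a" for m
    using that len d by (auto simp: x nth_append)
  show "part ?x l = (if l < d then part xs l + 1 else part xs (Suc l))"
  proof (cases "l < a")
    case True
    have "part ?x l + (a - 1 - l) = ?x ! (a - 1 - l)"
      using part_eq[OF sx, of l] True lx by simp
    also have "\<dots> = (if l < d then xs ! (a - l) else xs ! (a - Suc l))"
      using nth[of "a - 1 - l"] True d by (auto simp: Suc_diff_Suc)
    finally show ?thesis
      using part_eq[OF sorted, of l] part_eq[OF sorted, of "Suc l"] True len by (auto split: if_splits)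
  next
    case False
    then show ?thesis using d len lx by (simp add: part_def)
  qed
qed

text \<open>The partition of a row after omission, see \<open>part_omit_entry\<close>. It is also meaningful when \<open>d\<close>
  is the length of the row: then a fictitious entry \<open>- 1\<close> is omitted.\<close>

definition omitted :: "(nat \<Rightarrow> nat) \<Rightarrow> nat \<Rightarrow> nat \<Rightarrow> nat" where
  "omitted p d l = (if l < d then p l + 1 else p (Suc l))"

text \<open>This is the cancellation. Omitting the entries at positions \<open>d\<close> and \<open>Suc d\<close> leaves
  partitions which differ only in part \<open>d\<close>: it is \<open>p (Suc d)\<close> for the first and \<open>p d + 1\<close> for the second.
  So \<open>q\<close> interlaces with both as soon as its part \<open>d\<close> reaches the larger value and its part
  \<open>Suc d\<close> stays below the smaller one, and each interlacing condition implies one of these bounds.\<close>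

lemma omitted_exchange:
  assumes p: "\<And>i. p (Suc i) \<le> p i"
  shows "interlaces (omitted p d) q \<and> p d < q d \<longleftrightarrow>
     interlaces (omitted p (Suc d)) q \<and> q (Suc d) \<le> p (Suc d)"
proof (intro iffI conjI; elim conjE)
  assume il: "interlaces (omitted p d) q" and d: "p d < q d"
  have il1: "omitted p d i \<le> q i" "q (Suc i) \<le> omitted p d i" for i
    using il by (auto simp: interlaces_def)
  show "interlaces (omitted p (Suc d)) q"
    unfolding interlaces_def
  proof
    fix i show "omitted p (Suc d) i \<le> q i \<and> q (Suc i) \<le> omitted p (Suc d) i"
      using il1[of i] d p[of i] by (cases "i = d") (auto simp: omitted_def less_Suc_eq)
  qed
  show "q (Suc d) \<le> p (Suc d)"
    using il1(2)[of d] by (simp add: omitted_def)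
next
  assume il: "interlaces (omitted p (Suc d)) q" and d: "q (Suc d) \<le> p (Suc d)"
  have il1: "omitted p (Suc d) i \<le> q i" "q (Suc i) \<le> omitted p (Suc d) i" for i
    using il by (auto simp: interlaces_def)
  show "interlaces (omitted p d) q"
    unfolding interlaces_def
  proof
    fix i show "omitted p d i \<le> q i \<and> q (Suc i) \<le> omitted p d i"
      using il1[of i] d p[of i] by (cases "i = d") (auto simp: omitted_def less_Suc_eq)
  qed
  show "p d < q d"
    using il1(1)[of d] by (simp add: omitted_def)
qed

lemma alternating_sum_telescope:
  fixes f :: "nat \<Rightarrow> 'a::comm_ring_1"
  shows "(\<Sum>d\<le>n. (- 1) ^ d * (f d + f (Suc d))) = f 0 + (- 1) ^ n * f (Suc n)"
  by (induction n) (simp_all add: algebra_simps)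

locale extended_row =
  fixes ls ms :: "nat list" and N' k :: nat
  assumes symbol: "is_symbol (ls, ms)"
    and below: "ls \<noteq> [] \<longrightarrow> last ls < N'"
    and k_le: "k \<le> N'"
begin

definition row :: "nat list" where "row = ls @ [N']"

text \<open>The integer \<open>k\<^sup>(\<^sup>i\<^sup>)\<close> for the entry at position \<open>d\<close> from the top, that is \<open>i = length ls + 1 - d\<close>.\<close>

definition excess :: "nat \<Rightarrow> int" where
  "excess d = int k - int N' + int (row ! (length ls - d))"

definition omit :: "nat \<Rightarrow> symbol" where
  "omit d = (omit_entry (Suc (length ls) - d) row, ms)"

text \<open>The part of the \<open>d\<close>-th induced representation that does not cancel against the term with
  \<open>Suc d\<close>. The number of cells is the same in all levels.\<close>

definition level :: "nat \<Rightarrow> symbol set" where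
  "level d = {\<Lambda>'. is_symbol \<Lambda>' \<and> defect \<Lambda>' = defect (ls, ms) \<and>
     interlaces (omitted (part row) d) (part (fst \<Lambda>')) \<and> part (fst \<Lambda>') d \<le> part row d \<and>
     interlaces (part ms) (part (snd \<Lambda>')) \<and> cells \<Lambda>' = cells (ls, ms) + k}"

lemma length_row: "length row = Suc (length ls)"
  by (simp add: row_def)

lemma sorted_row: "sorted_wrt (<) row"
proof -
  have ls: "sorted_wrt (<) ls" using symbol by simp
  have "x < N'" if "x \<in> set ls" for x
  proof -
    have "ls \<noteq> []" using that by auto
    moreover have "x \<le> last ls"
      using ls that by (cases ls rule: rev_cases) (auto simp: sorted_wrt_append)
    ultimately show ?thesis using below by simp
  qed
  then show ?thesis using ls by (simp add: row_def sorted_wrt_append)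
qed

lemma row_le: "i \<le> length ls \<Longrightarrow> row ! i \<le> N'"
  using sorted_row sorted_wrt_nth_less[OF sorted_row, of i "length ls"]
  by (cases "i = length ls") (auto simp: row_def)

lemma omit_0: "omit 0 = (ls, ms)"
  by (simp add: omit_def omit_entry_def row_def)

lemmas omit_entry_row = part_omit_entry[OF sorted_row length_row]

lemma part_omit: "d \<le> length ls \<Longrightarrow> part (fst (omit d)) = omitted (part row) d"
  by (rule ext) (simp add: omit_def omitted_def omit_entry_row(4))

lemma defect_omit: "d \<le> length ls \<Longrightarrow> defect (omit d) = defect (ls, ms)"
  by (simp add: omit_def defect_def omit_entry_row(2))

text \<open>The first entry of the top row stays in place or is replaced by a larger one, so no second
  leading 0 can arise.\<close>

lemma is_symbol_omit:
  assumes d: "d \<le> length ls"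
  shows "is_symbol (omit d)"
proof -
  have nz: "hd (fst (omit d)) \<noteq> 0" if ne: "fst (omit d) \<noteq> []" and hd: "ls \<noteq> []" "hd ls \<noteq> 0"
  proof -
    obtain x xs where Cons: "ls = x # xs" and x: "x \<noteq> 0" using hd by (cases ls) auto
    have "row = x # xs @ [N']" unfolding row_def unfolding Cons by simp
    then have "0 < y" if "y \<in> set row" for y
      using sorted_row that x by auto
    moreover have "hd (fst (omit d)) \<in> set row"
      using hd_in_set[OF ne] by (auto simp: omit_def omit_entry_def dest: in_set_takeD in_set_dropD)
    ultimately show ?thesis by blast
  qed
  show ?thesis
  proof (cases "ls = []")
    case True
    then show ?thesis using d symbol omit_0 by simp
  next
    case False
    then show ?thesis
      using symbol omit_entry_row(1)[OF d] nz by (auto simp: omit_def)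
  qed
qed

text \<open>The rows \<open>ls\<close> and \<open>fst (omit d)\<close> have the same length, so their numbers of cells differ as
  their sums do.\<close>

lemma cells_omit:
  assumes d: "d \<le> length ls"
  shows "cells (omit d) + row ! (length ls - d) = cells (ls, ms) + N'"
proof -
  have ls: "sorted_wrt (<) ls" using symbol by simp
  have "sum_list (fst (omit d)) + row ! (length ls - d) = sum_list ls + N'"
    using omit_entry_row(3)[OF d] by (simp add: omit_def row_def)
  then show ?thesis
    using sum_list_row[OF ls] sum_list_row[OF omit_entry_row(1)[OF d]] omit_entry_row(2)[OF d]
    by (simp add: cells_def omit_def)
qed

text \<open>The strip symbols of \<open>omit d\<close> are split by comparing part \<open>d\<close> of their top row with that of
  \<open>row\<close>; by \<open>omitted_exchange\<close> the larger ones form the next level.\<close>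

lemma strip_symbols_omit:
  assumes d: "d \<le> length ls" and e: "excess d \<ge> 0"
  shows "strip_symbols (nat (excess d)) (omit d) = level d \<union> level (Suc d)"
    and "level d \<inter> level (Suc d) = {}"
proof -
  have cells: "cells (omit d) + nat (excess d) = cells (ls, ms) + k"
    using cells_omit[OF d] e by (simp add: excess_def)
  note exchange = omitted_exchange[of "part row" d, OF part_Suc_le[OF sorted_row]]
  show "strip_symbols (nat (excess d)) (omit d) = level d \<union> level (Suc d)"
  proof (rule Set.set_eqI)
    fix \<Lambda>'
    show "\<Lambda>' \<in> strip_symbols (nat (excess d)) (omit d) \<longleftrightarrow> \<Lambda>' \<in> level d \<union> level (Suc d)"
      using exchange[of "part (fst \<Lambda>')"]
      unfolding mem_strip_symbols_iff[OF is_symbol_omit[OF d]] part_omit[OF d] defect_omit[OF d] cells level_def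
      by (auto simp: omit_def not_le)
  qed
  show "level d \<inter> level (Suc d) = {}"
    using exchange by (auto simp: level_def not_le[symmetric])
qed

lemma cells_le:
  assumes "\<And>i. part xs i \<le> part (fst \<Lambda>) i" "interlaces (part ms) (part (snd \<Lambda>))"
  shows "cells (xs, ms) \<le> cells \<Lambda>"
  unfolding cells_def using assms
  by (intro add_mono card_mono finite_row_diagram) (auto simp: row_diagram_subset_iff interlaces_def)

text \<open>When \<open>excess d\<close> is negative, the partitions of \<open>omit d\<close> already have too many cells to fit
  into a symbol with \<open>k\<close> cells more than \<open>(ls, ms)\<close>.\<close>

lemma level_empty:
  assumes d: "d \<le> length ls" and e: "excess d < 0"
  shows "level d = {}"
proof -
  have False if \<Lambda>: "\<Lambda> \<in> level d" for \<Lambda>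
  proof -
    have "cells (omit d) \<le> cells \<Lambda>"
      unfolding omit_def using \<Lambda> part_omit[OF d]
      by (intro cells_le) (auto simp: level_def interlaces_def omit_def)
    then show False
      using \<Lambda> cells_omit[OF d] e by (simp add: level_def excess_def)
  qed
  then show ?thesis by blast
qed

text \<open>Past the last entry the same count applies to the row obtained by omitting a fictitious
  entry \<open>- 1\<close>, which is \<open>map Suc row\<close>. It has \<open>N' + 1\<close> cells more than \<open>ls\<close>, which is more than \<open>k\<close>.
  This is the place where the range of the dual pair enters, in the form \<open>k \<le> N'\<close>.\<close>

lemma level_beyond_row_empty: "level (Suc (length ls)) = {}"
proof -
  have ls: "sorted_wrt (<) ls" using symbol by simp
  have S: "sorted_wrt (<) (map Suc row)" using sorted_row by (simp add: sorted_wrt_map)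
  have part: "part (map Suc row) i \<le> omitted (part row) (Suc (length ls)) i" for i
    using part_eq[OF S, of i] part_eq[OF sorted_row, of i]
    by (cases "i < length row") (auto simp: omitted_def length_row part_def[of "map Suc row"])
  have "sum_list (map Suc xs) = sum_list xs + length xs" for xs
    by (induction xs) auto
  then have sum: "sum_list (map Suc row) = sum_list ls + N' + Suc (length ls)"
    by (simp add: row_def)
  have "2 * card (row_diagram (map Suc row)) + length ls * Suc (length ls) = 2 * sum_list (map Suc row)"
    using sum_list_row[OF S] by (simp add: length_row)
  moreover have "2 * sum_list ls = 2 * card (row_diagram ls) + length ls * (length ls - 1)"
    by (rule sum_list_row[OF ls])
  moreover have "length ls * Suc (length ls) = length ls * (length ls - 1) + 2 * length ls"
    by (cases "length ls") auto
  ultimately have cells: "cells (map Suc row, ms) = cells (ls, ms) + N' + 1"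
    using sum by (simp add: cells_def)
  have False if \<Lambda>: "\<Lambda> \<in> level (Suc (length ls))" for \<Lambda>
  proof -
    have "cells (map Suc row, ms) \<le> cells \<Lambda>"
      using \<Lambda> part by (intro cells_le) (auto simp: level_def interlaces_def intro: order_trans)
    then show False using \<Lambda> cells k_le by (simp add: level_def)
  qed
  then show ?thesis by blast
qed

text \<open>The omission at position 0 gives \<open>(ls, ms)\<close> back, and the remaining condition bounds the
  largest part of the top row by that of \<open>row\<close>, which is \<open>N' - length ls\<close>.\<close>

lemma level_0:
  "level 0 = {\<Lambda>' \<in> strip_symbols k (ls, ms).
     fst \<Lambda>' \<noteq> [] \<longrightarrow> int (last (fst \<Lambda>')) < int N' + (int (length (fst \<Lambda>')) - int (length ls))}"
proof (rule Set.set_eqI)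
  fix \<Lambda>'
  have N': "part row 0 + length ls = N'"
    using part_eq[OF sorted_row, of 0] by (simp add: length_row) (simp add: row_def)
  have "part (fst \<Lambda>') 0 \<le> part row 0 \<longleftrightarrow>
      (fst \<Lambda>' \<noteq> [] \<longrightarrow> int (last (fst \<Lambda>')) < int N' + (int (length (fst \<Lambda>')) - int (length ls)))"
    if "is_symbol \<Lambda>'"
  proof (cases "fst \<Lambda>' = []")
    case False
    have "part (fst \<Lambda>') 0 + (length (fst \<Lambda>') - 1) = last (fst \<Lambda>')"
      using part_eq[OF is_symbol_sorted(1)[OF that], of 0] False by (simp add: last_conv_nth)
    moreover have "length (fst \<Lambda>') > 0" using False by simp
    ultimately show ?thesis using N' False by linarith
  qed (simp add: part_def)
  then show "\<Lambda>' \<in> level 0 \<longleftrightarrow> \<Lambda>' \<in> {\<Lambda>' \<in> strip_symbols k (ls, ms).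
     fst \<Lambda>' \<noteq> [] \<longrightarrow> int (last (fst \<Lambda>')) < int N' + (int (length (fst \<Lambda>')) - int (length ls))}"
    using part_omit[of 0] by (auto simp: level_def mem_strip_symbols_iff[OF symbol] omit_0)
qed

lemma excess_mono:
  assumes "d \<le> d'" "d' \<le> length ls"
  shows "excess d' \<le> excess d"
proof (cases "d = d'")
  case False
  then have "row ! (length ls - d') < row ! (length ls - d)"
    using assms length_row by (intro sorted_wrt_nth_less[OF sorted_row]) auto
  then show ?thesis by (simp add: excess_def)
qed simp

text \<open>Every summand is the sum of two consecutive levels, so the alternating sum telescopes to its
  first and last level. The last one is empty: either its excess is negative, or it lies beyond the
  row.\<close>

theorem alternating_strip_sum:
  fixes f :: "symbol \<Rightarrow> 'a::comm_ring_1"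
  assumes m: "m \<le> length ls" "excess m \<ge> 0"
    and max: "m < length ls \<Longrightarrow> excess (Suc m) < 0"
  shows "(\<Sum>d\<le>m. (- 1) ^ d * (\<Sum>\<Lambda>'\<in>strip_symbols (nat (excess d)) (omit d). f \<Lambda>')) =
    (\<Sum>\<Lambda>'\<in>level 0. f \<Lambda>')"
proof -
  have "(\<Sum>\<Lambda>'\<in>strip_symbols (nat (excess d)) (omit d). f \<Lambda>') = sum f (level d) + sum f (level (Suc d))"
    if "d \<le> m" for d
  proof -
    have d: "d \<le> length ls" "excess d \<ge> 0" using that m excess_mono[of d m] by auto
    have "finite (level d \<union> level (Suc d))"
      unfolding strip_symbols_omit(1)[OF d, symmetric]
      by (rule finite_strip_symbols[OF is_symbol_omit[OF d(1)]])
    then show ?thesis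
      unfolding strip_symbols_omit(1)[OF d]
      using strip_symbols_omit(2)[OF d] by (intro sum.union_disjoint) auto
  qed
  then have "(\<Sum>d\<le>m. (- 1) ^ d * (\<Sum>\<Lambda>'\<in>strip_symbols (nat (excess d)) (omit d). f \<Lambda>')) =
      (\<Sum>d\<le>m. (- 1) ^ d * (sum f (level d) + sum f (level (Suc d))))"
    by (intro sum.cong refl) simp
  also have "\<dots> = sum f (level 0) + (- 1) ^ m * sum f (level (Suc m))"
    by (rule alternating_sum_telescope)
  also have "level (Suc m) = {}"
    using m(1) level_beyond_row_empty level_empty[of "Suc m"] max
    by (cases "m = length ls") auto
  finally show ?thesis by simp
qed

lemma omit_mem_symbols:
  assumes \<Lambda>: "(ls, ms) \<in> symbols t r" and d: "d \<le> length ls"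
  shows "omit d \<in> symbols t (r + (N' - row ! (length ls - d)))"
proof -
  have "row ! (length ls - d) \<le> N'" by (rule row_le) simp
  then have "cells (omit d) = cells (ls, ms) + (N' - row ! (length ls - d))"
    using cells_omit[OF d] by simp
  then show ?thesis
    using \<Lambda> is_symbol_omit[OF d] defect_omit[OF d]
    by (auto simp: mem_symbols_iff algebra_simps split: if_splits)
qed

end

section \<open>Constituents of induced unipotent characters\<close>

lemma unipotent_labellingD:
  assumes "unipotent_labelling unip"
  shows "\<Lambda> \<in> symbols t r \<Longrightarrow> unip t \<Lambda> \<in> irr_chars (cls_group t r)"
    and "\<Lambda> \<in> symbols t r \<Longrightarrow> \<Lambda>' \<in> symbols t r \<Longrightarrow>
      unip t \<Lambda> = unip t \<Lambda>' \<longleftrightarrow> \<Lambda>' = \<Lambda> \<or> (t = TypeB \<or> t = TypeC) \<and> \<Lambda>' = prod.swap \<Lambda>"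
    and "\<Lambda> \<in> symbols t r \<Longrightarrow> g \<in> carrier (cls_group t (r + j)) \<Longrightarrow>
      hc_ind t (r + j) j (unip t \<Lambda>) g = (\<Sum>\<Lambda>'\<in>strip_symbols j \<Lambda>. unip t \<Lambda>' g)"
  using assms unfolding unipotent_labelling_def by (elim conjE; simp)+

text \<open>By orthogonality a character is a constituent exactly if it occurs among the summands of the
  decomposition into strip symbols.\<close>

lemma constituent_hc_ind_iff:
  fixes unip :: "cls_type \<Rightarrow> symbol \<Rightarrow> 'f::{field,finite} mat \<Rightarrow> complex"
  assumes q: "odd (card (UNIV :: 'f set))" and unip: "unipotent_labelling unip"
    and \<Lambda>: "\<Lambda> \<in> symbols t r" and \<Lambda>': "\<Lambda>' \<in> symbols t (r + k)" and d: "defect \<Lambda>' = defect \<Lambda>"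
  shows "constituent (cls_group t (r + k)) (unip t \<Lambda>') (hc_ind t (r + k) k (unip t \<Lambda>)) \<longleftrightarrow>
         \<Lambda>' \<in> strip_symbols k \<Lambda>"
proof -
  let ?G = "cls_group t (r + k) :: 'f mat monoid"
  interpret group ?G by (rule group_cls_group[OF q])
  have sym: "is_symbol \<Lambda>" using \<Lambda> by (simp add: symbols_def)
  have irr: "unip t M \<in> irr_chars ?G" if "M \<in> symbols t (r + k)" for M
    using unipotent_labellingD(1)[OF unip that] .
  note sub = strip_symbols_subset_symbols[OF \<Lambda>, of k]
  have eq: "unip t \<Lambda>' = unip t M \<longleftrightarrow> \<Lambda>' = M" if M: "M \<in> strip_symbols k \<Lambda>" for M
  proof -
    have "unip t \<Lambda>' = unip t M \<longleftrightarrow> M = \<Lambda>' \<or> (t = TypeB \<or> t = TypeC) \<and> M = prod.swap \<Lambda>'"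
      using sub M by (intro unipotent_labellingD(2)[OF unip \<Lambda>']) blast
    moreover have "M \<noteq> prod.swap \<Lambda>'" if "t = TypeB \<or> t = TypeC"
    proof
      \<comment> \<open>exchanging the rows negates the defect, which is odd in types B and C\<close>
      assume "M = prod.swap \<Lambda>'"
      then have "defect M = - defect \<Lambda>'" by (simp add: defect_def)
      moreover have "defect M = defect \<Lambda>'" using M d by (simp add: strip_symbols_def)
      moreover have "odd (defect \<Lambda>')" using \<Lambda>' that by (auto simp: mem_symbols_iff)
      ultimately show False by simp
    qed
    ultimately show ?thesis by auto
  qed
  have "char_inner ?G (unip t \<Lambda>') (hc_ind t (r + k) k (unip t \<Lambda>)) =
      (\<Sum>g\<in>carrier ?G. unip t \<Lambda>' (inv\<^bsub>?G\<^esub> g) * (\<Sum>M\<in>strip_symbols k \<Lambda>. unip t M g)) / of_nat (card (carrier ?G))"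
    by (simp add: char_inner_def unipotent_labellingD(3)[OF unip \<Lambda>])
  also have "\<dots> = (\<Sum>M\<in>strip_symbols k \<Lambda>. char_inner ?G (unip t \<Lambda>') (unip t M))"
    unfolding char_inner_def sum_divide_distrib[symmetric] sum_distrib_left
    by (subst sum.swap) simp
  also have "\<dots> = (\<Sum>M\<in>strip_symbols k \<Lambda>. if \<Lambda>' = M then 1 else 0)"
  proof (intro sum.cong refl)
    fix M assume M: "M \<in> strip_symbols k \<Lambda>"
    then have "M \<in> symbols t (r + k)" using sub by blast
    from char_inner_irr_chars[OF group_cls_group[OF q] finite_cls_group irr[OF \<Lambda>'] irr[OF this]]
    show "char_inner ?G (unip t \<Lambda>') (unip t M) = (if \<Lambda>' = M then 1 else 0)"
      unfolding eq[OF M] .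
  qed
  also have "\<dots> = (if \<Lambda>' \<in> strip_symbols k \<Lambda> then 1 else 0)"
    using finite_strip_symbols[OF sym] by simp
  finally show ?thesis using irr[OF \<Lambda>'] by (simp add: constituent_def)
qed

section \<open>The altered factor and the new coordinate\<close>

text \<open>This is needed when the new coordinate goes to the bottom row of the altered symbol and the
  rows are exchanged.\<close>

lemma swap_mem_symbols_iff: "prod.swap \<Lambda> \<in> symbols t r \<longleftrightarrow> \<Lambda> \<in> symbols t r"
proof -
  have d: "defect (prod.swap \<Lambda>) = - defect \<Lambda>" by (simp add: defect_def)
  have c: "cells (prod.swap \<Lambda>) = cells \<Lambda>" by (simp add: cells_def)
  have "is_symbol (prod.swap \<Lambda>) \<longleftrightarrow> is_symbol \<Lambda>" by (cases \<Lambda>) auto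
  moreover have "- x mod 4 = 0 \<longleftrightarrow> x mod 4 = 0" "- x mod 4 = 2 \<longleftrightarrow> x mod 4 = 2" for x :: int
    by presburger+
  ultimately show ?thesis by (simp add: mem_symbols_iff d c)
qed

text \<open>The ranges make \<open>N - m\<close> resp. \<open>m - N\<close> non-negative, and even positive where \<open>n - 1\<close> is
  halved, which covers the value \<open>- 1\<close> of that half at \<open>n = 0\<close>.\<close>

lemma new_coord_ge:
  assumes "in_range sd A B"
  shows "int k \<le> new_coord sd A B k n"
  using assms by (cases sd) (auto simp: new_coord_def Let_def split: if_splits)

theorem theorem6p1p2:
  fixes A B U :: "'f::{field,finite} mat"
    and sd :: side
    and k r N' i0 :: nat
    and L :: "('f mat \<Rightarrow> complex) \<Rightarrow> ('f, 'd) lusztig_datum"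
    and \<rho> :: "'f mat \<Rightarrow> complex"
    and unip :: "cls_type \<Rightarrow> symbol \<Rightarrow> 'f mat \<Rightarrow> complex"
    and t :: cls_type
    and ls ms lsN :: "nat list"
    and kk :: "nat \<Rightarrow> int"
  assumes q_odd: "odd (card (UNIV :: 'f set))"
    and V: "symplectic_form A"
    and W: "orthogonal_form B"
    and in_range: "in_range sd A B"
    and compl: "k_complement sd A B k U"
    and rho: "\<rho> \<in> irr_chars (isom_group U)"
    and lusztig: "lusztig_parametrization sd (dim_row B) U L"
    and labelling: "unipotent_labelling unip"
    and theta: "(ls, ms) = top_arranged (L \<rho>)"
    and theta_type: "t = altered_type sd (dim_row B) U (ss_part (L \<rho>))"
    and theta_rank: "r = altered_rank (dim_row B) (ss_part (L \<rho>))"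
    and N'_eq: "int N' = new_coord sd A B k (length ls + length ms)"
    and below: "ls \<noteq> [] \<longrightarrow> last ls < N'"
    and lsN_eq: "lsN = ls @ [N']"
    and kk_eq: "\<And>i. kk i = int k - int N' + int (lsN ! (i - 1))"
    and i0_eq: "i0 = (LEAST i. 1 \<le> i \<and> i \<le> length ls + 1 \<and> kk i \<ge> 0)"
  shows "\<forall>g \<in> carrier (cls_group t (r + k)).
    (\<Sum>i = i0..length ls + 1.
       (- 1) ^ (length ls + 1 - i) *
       hc_ind t (r + k) (nat (kk i)) (unip t (omit_entry i lsN, ms)) g)
    = (\<Sum>\<Lambda>' \<in> {\<Lambda>' \<in> symbols t (r + k).
          defect \<Lambda>' = defect (ls, ms) \<and>
          constituent (cls_group t (r + k)) (unip t \<Lambda>') (hc_ind t (r + k) k (unip t (ls, ms))) \<and>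
          (fst \<Lambda>' \<noteq> [] \<longrightarrow>
             int (last (fst \<Lambda>')) < int N' + (int (length (fst \<Lambda>')) - int (length ls)))}.
        unip t \<Lambda>' g)"
proof
  fix g assume g: "g \<in> carrier (cls_group t (r + k) :: 'f mat monoid)"
  have "altered (L \<rho>) \<in> symbols t r"
    using lusztig rho theta_type theta_rank by (simp add: lusztig_parametrization_def Let_def)
  then have \<theta>: "(ls, ms) \<in> symbols t r"
    using theta by (cases "append_row (L \<rho>)") (auto simp: top_arranged_def swap_mem_symbols_iff)
  have "k \<le> N'" using new_coord_ge[OF in_range, of k "length ls + length ms"] N'_eq by linarith
  then interpret extended_row ls ms N' k
    using \<theta> below by unfold_locales (auto simp: symbols_def)
  let ?a = "length ls"
  have kk: "kk i = excess (Suc ?a - i)" if "1 \<le> i" "i \<le> Suc ?a" for i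
  proof -
    have "?a - (Suc ?a - i) = i - 1" using that by simp
    then show ?thesis by (simp add: kk_eq lsN_eq excess_def row_def)
  qed
  have "1 \<le> Suc ?a \<and> Suc ?a \<le> ?a + 1 \<and> kk (Suc ?a) \<ge> 0"
    by (simp add: kk_eq lsN_eq)
  then have "1 \<le> i0 \<and> i0 \<le> ?a + 1 \<and> kk i0 \<ge> 0"
    unfolding i0_eq by (rule LeastI)
  then have i0: "1 \<le> i0" "i0 \<le> Suc ?a" "kk i0 \<ge> 0" by auto
  have below_i0: "kk (i0 - 1) < 0" if "1 < i0"
    using not_less_Least[of "i0 - 1" "\<lambda>i. 1 \<le> i \<and> i \<le> length ls + 1 \<and> kk i \<ge> 0"] that i0
    unfolding i0_eq[symmetric] by linarith
  define m where "m = Suc ?a - i0"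
  have m: "m \<le> ?a" "excess m \<ge> 0" using i0 kk[of i0] by (auto simp: m_def)
  have max: "excess (Suc m) < 0" if "m < ?a"
  proof -
    have "1 < i0" "Suc ?a - (i0 - 1) = Suc m" using that i0 by (auto simp: m_def)
    then show ?thesis using below_i0 kk[of "i0 - 1"] i0 by simp
  qed
  \<comment> \<open>the omission raises the rank by \<open>N' - \<lambda>\<^sub>i\<close>, which the smaller strip compensates\<close>
  have summand: "hc_ind t (r + k) (nat (excess d)) (unip t (omit d)) g =
      (\<Sum>\<Lambda>'\<in>strip_symbols (nat (excess d)) (omit d). unip t \<Lambda>' g)" if "d \<le> m" for d
  proof -
    have d: "d \<le> ?a" "excess d \<ge> 0" using that m excess_mono[of d m] by auto
    define r' where "r' = r + (N' - row ! (?a - d))"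
    have "r' + nat (excess d) = r + k"
      using d(2) row_le[of "?a - d"] by (auto simp: r'_def excess_def)
    moreover have "omit d \<in> symbols t r'"
      unfolding r'_def by (rule omit_mem_symbols[OF \<theta> d(1)])
    ultimately show ?thesis
      using unipotent_labellingD(3)[OF labelling, of "omit d" t r' g "nat (excess d)"] g by simp
  qed
  \<comment> \<open>count the omitted entries from the top, so that the first term is the induction of \<open>\<theta>\<close> itself\<close>
  have "(\<Sum>i = i0..?a + 1. (- 1) ^ (?a + 1 - i) *
        hc_ind t (r + k) (nat (kk i)) (unip t (omit_entry i lsN, ms)) g) =
      (\<Sum>d\<le>m. (- 1) ^ d * hc_ind t (r + k) (nat (excess d)) (unip t (omit d)) g)"
    by (rule sum.reindex_bij_witness[where i = "\<lambda>d. Suc ?a - d" and j = "\<lambda>i. Suc ?a - i"])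
      (use i0 in \<open>auto simp: m_def kk omit_def row_def lsN_eq\<close>)
  also have "\<dots> = (\<Sum>d\<le>m. (- 1) ^ d * (\<Sum>\<Lambda>'\<in>strip_symbols (nat (excess d)) (omit d). unip t \<Lambda>' g))"
    by (intro sum.cong refl) (simp add: summand)
  also have "\<dots> = (\<Sum>\<Lambda>'\<in>level 0. unip t \<Lambda>' g)"
    by (rule alternating_strip_sum[OF m max])
  also have "level 0 = {\<Lambda>' \<in> symbols t (r + k).
          defect \<Lambda>' = defect (ls, ms) \<and>
          constituent (cls_group t (r + k)) (unip t \<Lambda>') (hc_ind t (r + k) k (unip t (ls, ms))) \<and>
          (fst \<Lambda>' \<noteq> [] \<longrightarrow>
             int (last (fst \<Lambda>')) < int N' + (int (length (fst \<Lambda>')) - int (length ls)))}"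
  proof -
    have "defect \<Lambda>' = defect (ls, ms)" if "\<Lambda>' \<in> strip_symbols k (ls, ms)" for \<Lambda>'
      using that by (simp add: strip_symbols_def)
    then show ?thesis
      using constituent_hc_ind_iff[OF q_odd labelling \<theta>] strip_symbols_subset_symbols[OF \<theta>, of k]
      unfolding level_0 by blast
  qed
  finally show "(\<Sum>i = i0..?a + 1. (- 1) ^ (?a + 1 - i) *
        hc_ind t (r + k) (nat (kk i)) (unip t (omit_entry i lsN, ms)) g) =
      (\<Sum>\<Lambda>' \<in> {\<Lambda>' \<in> symbols t (r + k).
          defect \<Lambda>' = defect (ls, ms) \<and>
          constituent (cls_group t (r + k)) (unip t \<Lambda>') (hc_ind t (r + k) k (unip t (ls, ms))) \<and>
          (fst \<Lambda>' \<noteq> [] \<longrightarrow>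
             int (last (fst \<Lambda>')) < int N' + (int (length (fst \<Lambda>')) - int (length ls)))}.
        unip t \<Lambda>' g)" .
qed

end
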